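(* Let $n\geq 2$, let $D\subset\mathbb R^n_+$ be a domain, and let $f:D\to\mathbb R_+$, $f(\mathbf x)=F(h_1(x_1)+\cdots+h_n(x_n))$, be a quasi-sum production function satisfying the constant elasticity of substitution property. Then the graph of $f$ has vanishing Gauss-Kronecker curvature if and only if $f$ is one of the following functions: (1) a linearly homogeneous generalized ACMS production function given by $$f(\mathbf x)=\gamma\Big(\sum_{i=1}^n a_i^{\rho}x_i^{\rho}\Big)^{\frac1\rho}$$ for some nonzero constants $\gamma,a_1,\ldots,a_n,\rho$; (2) a linearly homogeneous generalized Cobb-Douglas production function given by $$f(\mathbf x)=\gamma x_1^{\alpha_1}\cdots x_n^{\alpha_n},\qquad \sum_{i=1}^n\alpha_i=1,$$ for some nonzero constants $\gamma,\alpha_1,\ldots,\alpha_n$.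
   Context: $\mathbb R_+=\{r\in\mathbb R: r>0\}$ and $\mathbb R^n_+=\{(x_1,\ldots,x_n)\in\mathbb R^n: x_1,\ldots,x_n>0\}$; $\mathbf x=(x_1,\ldots,x_n)$. Subscripts of $f$ denote partial derivatives. A production function is a twice differentiable function $f:D\to\mathbb R_+$, on a domain $D\subset\mathbb R^n_+$, with non-vanishing first partial derivatives. It is called quasi-sum if there exist strictly monotone functions $F,h_1,\ldots,h_n$ of one variable with $F'>0$ such that $f(\mathbf x)=F(h_1(x_1)+\cdots+h_n(x_n))$. For $1\le i\ne j\le n$, the Hicks elasticity of substitution of the $i$-th input with respect to the $j$-th input is $$H_{ij}(\mathbf x)=\frac{\dfrac{1}{x_if_{x_i}}+\dfrac{1}{x_jf_{x_j}}}{-\dfrac{f_{x_ix_i}}{f_{x_i}^2}+\dfrac{2f_{x_ix_j}}{f_{x_i}f_{x_j}}-\dfrac{f_{x_jx_j}}{f_{x_j}^2}},$$ where all partial derivatives are taken at $\mathbf x$ and the denominator is assumed to be different from zero. $f$ satisfies the constant elasticity of substitution property if there is a nonzero constant $\sigma\in\mathbb R$ such that $H_{ij}(\mathbf x)=\sigma$ for all $\mathbf x\in D$ and all $1\le i\ne j\le n$. The graph of $f$ is the hypersurface $\{(x_1,\ldots,x_n,f(x_1,\ldots,x_n)):\mathbf x\in D\}$ of Euclidean space $\mathbb E^{n+1}$. The Gauss-Kronecker curvature of a hypersurface is the determinant of its shape operator (the product of its principal curvatures). A generalized ACMS production function is one of the form $\gamma\big(\sum_{i=1}^n a_i^\rho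 x_i^\rho\big)^{d/\rho}$ with $a_1,\ldots,a_n,\gamma,\rho\neq0$; a generalized Cobb-Douglas production function is one of the form $\gamma x_1^{\alpha_1}\cdots x_n^{\alpha_n}$ with $\gamma>0$ and $\alpha_1,\ldots,\alpha_n\ne 0$. Linearly homogeneous means homogeneous of degree one, i.e. $f(t\mathbf x)=tf(\mathbf x)$ whenever both sides are defined.
   Formalization: Forms (1), (2) are proved for f − c with some real constant c, since 1+sqrt(x₁x₂) refutes the literal claim; in (1) the a_i may be complex with a_i^ρ any real value of the power, so coefficients may be negative, as sqrt(x₁²−x₂²) requires. *)

theory Defs
  imports "HOL-Analysis.Analysis"
begin

text \<open>
  Functions on a domain \<open>D\<close> of Euclidean \<open>n\<close>-space are total functions on \<^typ>\<open>real ^ 'n\<close>. As \<open>D\<close> is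
  open, every notion below depends only on their values on \<open>D\<close>.
\<close>

definition partial :: "'n \<Rightarrow> (real ^ 'n \<Rightarrow> real) \<Rightarrow> real ^ 'n \<Rightarrow> real" where
  "partial i f x = deriv (\<lambda>t. f (x + t *\<^sub>R axis i 1)) 0"

text \<open>Total (Frechet) differentiability of \<open>f\<close> and of all its first partial derivatives.\<close>

definition twice_differentiable_on :: "(real ^ 'n \<Rightarrow> real) \<Rightarrow> (real ^ 'n) set \<Rightarrow> bool"
    (infix \<open>twice'_differentiable'_on\<close> 50) where
  "f twice_differentiable_on D \<longleftrightarrow>
     f differentiable_on D \<and> (\<forall>i. partial i f differentiable_on D)"

definition positive_orthant :: "(real ^ 'n) set" where
  "positive_orthant = {x. \<forall>i. 0 < x $ i}"

definition domain_in_orthant :: "(real ^ 'n) set \<Rightarrow> bool" where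
  "domain_in_orthant D \<longleftrightarrow> open D \<and> connected D \<and> D \<noteq> {} \<and> D \<subseteq> positive_orthant"

definition production_function :: "(real ^ 'n) set \<Rightarrow> (real ^ 'n \<Rightarrow> real) \<Rightarrow> bool" where
  "production_function D f \<longleftrightarrow>
     f twice_differentiable_on D \<and>
     (\<forall>x\<in>D. 0 < f x) \<and> (\<forall>x\<in>D. \<forall>i. partial i f x \<noteq> 0)"

definition strictly_monotone_on :: "real set \<Rightarrow> (real \<Rightarrow> real) \<Rightarrow> bool" where
  "strictly_monotone_on A g \<longleftrightarrow> strict_mono_on A g \<or> strict_antimono_on A g"

text \<open>
  The inner function \<open>h i\<close> lives on the projection of \<open>D\<close> to the \<open>i\<close>-th axis, the outer function \<open>F\<close>
  on an open interval \<open>J\<close>. No regularity of the \<open>h i\<close> is assumed.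
\<close>

definition quasi_sum :: "(real ^ 'n) set \<Rightarrow> (real ^ 'n \<Rightarrow> real) \<Rightarrow> bool" where
  "quasi_sum D f \<longleftrightarrow>
     (\<exists>(F :: real \<Rightarrow> real) (h :: 'n \<Rightarrow> real \<Rightarrow> real) J.
        open J \<and> is_interval J \<and>
        strictly_monotone_on J F \<and>
        (\<forall>u\<in>J. F field_differentiable (at u) \<and> 0 < deriv F u) \<and>
        (\<forall>i. strictly_monotone_on ((\<lambda>x. x $ i) ` D) (h i)) \<and>
        (\<forall>x\<in>D. (\<Sum>i\<in>UNIV. h i (x $ i)) \<in> J \<and> f x = F (\<Sum>i\<in>UNIV. h i (x $ i))))"

definition hicks_denominator :: "(real ^ 'n \<Rightarrow> real) \<Rightarrow> 'n \<Rightarrow> 'n \<Rightarrow> real ^ 'n \<Rightarrow> real" where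
  "hicks_denominator f i j x =
     - (partial i (partial i f) x / (partial i f x)\<^sup>2)
     + 2 * partial j (partial i f) x / (partial i f x * partial j f x)
     - partial j (partial j f) x / (partial j f x)\<^sup>2"

definition hicks_elasticity :: "(real ^ 'n \<Rightarrow> real) \<Rightarrow> 'n \<Rightarrow> 'n \<Rightarrow> real ^ 'n \<Rightarrow> real" where
  "hicks_elasticity f i j x =
     (1 / (x $ i * partial i f x) + 1 / (x $ j * partial j f x)) / hicks_denominator f i j x"

definition CES_property :: "(real ^ 'n) set \<Rightarrow> (real ^ 'n \<Rightarrow> real) \<Rightarrow> bool" where
  "CES_property D f \<longleftrightarrow>
     (\<exists>\<sigma>. \<sigma> \<noteq> 0 \<and>
        (\<forall>x\<in>D. \<forall>i j. i \<noteq> j \<longrightarrow>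
           hicks_denominator f i j x \<noteq> 0 \<and> hicks_elasticity f i j x = \<sigma>))"

text \<open>
  For a hypersurface parametrised by \<open>\<phi>\<close> with unit normal field \<open>\<nu>\<close>, the shape operator at \<open>\<phi> x\<close> is
  the endomorphism of the tangent space sending \<open>D\<phi>(v)\<close> to \<open>- D\<nu>(v)\<close>. It is expressed here in the
  parameter coordinates, i.e. with respect to the basis of coordinate tangent vectors.
\<close>

definition shape_operator ::
  "(real ^ 'n \<Rightarrow> 'e::euclidean_space) \<Rightarrow> (real ^ 'n \<Rightarrow> 'e) \<Rightarrow> real ^ 'n \<Rightarrow> real ^ 'n \<Rightarrow> real ^ 'n" where
  "shape_operator \<phi> \<nu> x =
     (THE S. linear S \<and>
        (\<forall>v. frechet_derivative \<phi> (at x) (S v) = - frechet_derivative \<nu> (at x) v))"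

definition Gauss_Kronecker_curvature ::
  "(real ^ 'n \<Rightarrow> 'e::euclidean_space) \<Rightarrow> (real ^ 'n \<Rightarrow> 'e) \<Rightarrow> real ^ 'n \<Rightarrow> real" where
  "Gauss_Kronecker_curvature \<phi> \<nu> x = det (matrix (shape_operator \<phi> \<nu> x))"

text \<open>
  Euclidean \<open>(n+1)\<close>-space is \<^typ>\<open>(real ^ 'n) \<times> real\<close>, and the graph carries its upward unit normal.
  The opposite normal only multiplies the Gauss-Kronecker curvature by \<open>(-1)^n\<close>.
\<close>

definition graph_param :: "(real ^ 'n \<Rightarrow> real) \<Rightarrow> real ^ 'n \<Rightarrow> (real ^ 'n) \<times> real" where
  "graph_param f x = (x, f x)"

definition graph_normal :: "(real ^ 'n \<Rightarrow> real) \<Rightarrow> real ^ 'n \<Rightarrow> (real ^ 'n) \<times> real" where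
  "graph_normal f x =
     (1 / sqrt (1 + (\<Sum>i\<in>UNIV. (partial i f x)\<^sup>2))) *\<^sub>R (- (\<chi> i. partial i f x), 1)"

definition graph_has_vanishing_GK_curvature ::
  "(real ^ 'n) set \<Rightarrow> (real ^ 'n \<Rightarrow> real) \<Rightarrow> bool" where
  "graph_has_vanishing_GK_curvature D f \<longleftrightarrow>
     (\<forall>x\<in>D. Gauss_Kronecker_curvature (graph_param f) (graph_normal f) x = 0)"

definition linearly_homogeneous_on :: "(real ^ 'n) set \<Rightarrow> (real ^ 'n \<Rightarrow> real) \<Rightarrow> bool" where
  "linearly_homogeneous_on D f \<longleftrightarrow>
     (\<forall>x\<in>D. \<forall>t. t *\<^sub>R x \<in> D \<longrightarrow> f (t *\<^sub>R x) = t * f x)"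

text \<open>
  \<open>is_real_power a \<rho> c\<close>: the real number \<open>c\<close> is a value of the (multivalued) complex power
  \<open>a\<^sup>\<rho>\<close>. For \<open>a > 0\<close> this includes \<open>c = a powr \<rho>\<close>. The constants \<open>a\<^sub>i\<close> of an ACMS function are only
  required to be nonzero, and the coefficients \<open>a\<^sub>i\<^sup>\<rho>\<close> may be negative, which positive
  \<open>a\<^sub>i\<close> cannot produce: for instance \<open>sqrt (x\<^sub>1\<^sup>2 - x\<^sub>2\<^sup>2)\<close> is the ACMS
  function with \<open>\<rho> = 2\<close>, \<open>a\<^sub>1 = 1\<close>, \<open>a\<^sub>2 = \<i>\<close>.
\<close>

definition is_real_power :: "complex \<Rightarrow> real \<Rightarrow> real \<Rightarrow> bool" where
  "is_real_power a \<rho> c \<longleftrightarrow> (\<exists>L. exp L = a \<and> complex_of_real c = exp (complex_of_real \<rho> * L))"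

text \<open>
  The power with exponent \<open>d / \<rho>\<close> is a real power, so the sum is required to be positive.
\<close>

definition generalized_ACMS_on :: "(real ^ 'n) set \<Rightarrow> real \<Rightarrow> (real ^ 'n \<Rightarrow> real) \<Rightarrow> bool" where
  "generalized_ACMS_on D d f \<longleftrightarrow>
     (\<exists>\<gamma> \<rho> (a :: 'n \<Rightarrow> complex) (c :: 'n \<Rightarrow> real).
        \<gamma> \<noteq> 0 \<and> \<rho> \<noteq> 0 \<and> (\<forall>i. a i \<noteq> 0 \<and> is_real_power (a i) \<rho> (c i)) \<and>
        (\<forall>x\<in>D. 0 < (\<Sum>i\<in>UNIV. c i * (x $ i) powr \<rho>) \<and>
               f x = \<gamma> * (\<Sum>i\<in>UNIV. c i * (x $ i) powr \<rho>) powr (d / \<rho>)))"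

definition generalized_Cobb_Douglas_on ::
  "(real ^ 'n) set \<Rightarrow> ('n \<Rightarrow> real) \<Rightarrow> (real ^ 'n \<Rightarrow> real) \<Rightarrow> bool" where
  "generalized_Cobb_Douglas_on D \<alpha> f \<longleftrightarrow>
     (\<forall>i. \<alpha> i \<noteq> 0) \<and>
     (\<exists>\<gamma>. \<gamma> \<noteq> 0 \<and> (\<forall>x\<in>D. f x = \<gamma> * (\<Prod>i\<in>UNIV. (x $ i) powr \<alpha> i)))"

text \<open>
  A vertical translation of the graph affects neither its curvature nor the Hicks elasticities:
  \<open>1 + sqrt (x\<^sub>1 * x\<^sub>2)\<close> is a quasi-sum production function with constant elasticity of substitution
  and a graph of vanishing Gauss-Kronecker curvature, but it is not linearly homogeneous. The ACMS
  and Cobb-Douglas predicates are therefore meant to be applied to \<open>\<lambda>x. f x - c\<close> for a constant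
  \<open>c\<close>. As \<open>f - c\<close> may be negative, \<open>\<gamma>\<close> is only required to be nonzero.
\<close>

end

theory Submission
  imports Defs
begin

text \<open>
  Write \<open>f = F (u x)\<close> with \<open>u x = (\<Sum>i. h\<^sub>i (x\<^sub>i))\<close>. Inverting \<open>F\<close>, and then \<open>u\<close> along an axis, shows that
  \<open>F\<close> and the \<open>h\<^sub>i\<close> are twice differentiable where needed. Constant elasticity \<open>\<sigma>\<close> then reads
  \<open>g\<^sub>i (x\<^sub>i) + g\<^sub>j (x\<^sub>j) = 0\<close> for \<open>g\<^sub>i t = 1 / (t h\<^sub>i') + \<sigma> h\<^sub>i'' / h\<^sub>i'\<^sup>2\<close>, so each \<open>g\<^sub>i\<close> is a constant \<open>\<kappa>\<^sub>i\<close>, and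
  either all \<open>\<kappa>\<^sub>i\<close> vanish or \<open>n = 2\<close> and \<open>\<kappa>\<^sub>1 = - \<kappa>\<^sub>2 \<noteq> 0\<close>. The curvature vanishes exactly where the Hessian
  has a nontrivial kernel.

  If all \<open>\<kappa>\<^sub>i\<close> vanish, then \<open>h\<^sub>i'\<close> is a multiple of \<open>t\<close> to the power \<open>- 1 / \<sigma>\<close> and the kernel condition is
  \<open>F' = \<sigma> F'' E\<close> with \<open>E = (\<Sum>i. x\<^sub>i h\<^sub>i')\<close>. Hence \<open>f - E F'\<close> is a constant \<open>c\<close>, and integrating the logarithmic
  derivative of \<open>f - c\<close> yields the ACMS form for \<open>\<sigma> \<noteq> 1\<close> and the Cobb-Douglas form for \<open>\<sigma> = 1\<close>.

  The remaining case is impossible: with \<open>p\<^sub>i = 1 / (t h\<^sub>i')\<close> the kernel condition is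
  \<open>F'' / F' = (p\<^sub>1 - \<kappa>) (p\<^sub>2 + \<kappa>) / (\<sigma> (p\<^sub>1 + p\<^sub>2))\<close>. As the left side is a function of \<open>u\<close>, comparing the partial
  derivatives gives a polynomial relation between \<open>p\<^sub>1\<close> and \<open>p\<^sub>2\<close> that forces both to be critical, and
  then \<open>p\<^sub>1 + p\<^sub>2 = 0\<close>, which makes the Hicks denominator vanish.

  Conversely, the gradient of a function homogeneous of degree one up to a constant is constant along
  rays, so the position vector lies in the kernel of the Hessian.
\<close>

subsection \<open>Partial derivatives and the curvature of a graph\<close>

lemma deriv_along_line:
  fixes f :: "'a::real_normed_vector \<Rightarrow> real"
  assumes "(f has_derivative f') (at x)"
  shows "((\<lambda>t. f (x + t *\<^sub>R v)) has_field_derivative f' v) (at 0)"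
proof -
  interpret linear f' using assms by (rule has_derivative_linear)
  have "((\<lambda>t. x + t *\<^sub>R v) has_derivative (\<lambda>t. t *\<^sub>R v)) (at 0)"
    by (auto intro!: derivative_eq_intros)
  then have "((\<lambda>t. f (x + t *\<^sub>R v)) has_derivative (\<lambda>t. f' (t *\<^sub>R v))) (at 0)"
    by (rule has_derivative_compose) (simp add: assms)
  moreover have "(\<lambda>t. f' (t *\<^sub>R v)) = (*) (f' v)"
    by (simp add: fun_eq_iff scale)
  ultimately show ?thesis
    by (simp add: has_field_derivative_def)
qed

lemma partial_eq:
  assumes "(f has_derivative f') (at x)"
  shows "partial i f x = f' (axis i 1)"
  unfolding partial_def by (rule DERIV_imp_deriv[OF deriv_along_line[OF assms]])

lemma linear_expand_axis:
  fixes g :: "real ^ 'n \<Rightarrow> real"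
  assumes "linear g"
  shows "g v = (\<Sum>i\<in>UNIV. v $ i * g (axis i 1))"
proof -
  have "g v = g (\<Sum>i\<in>UNIV. v $ i *\<^sub>R axis i 1)"
    by (simp only: basis_expansion[of v, unfolded scalar_mult_eq_scaleR])
  also have "\<dots> = (\<Sum>i\<in>UNIV. v $ i * g (axis i 1))"
    by (simp only: linear_sum[OF assms] linear_scale[OF assms] real_scaleR_def)
  finally show ?thesis .
qed

lemma has_derivative_partial:
  assumes "f differentiable at x"
  shows "(f has_derivative (\<lambda>v. \<Sum>i\<in>UNIV. v $ i * partial i f x)) (at x)"
proof -
  obtain f' where f': "(f has_derivative f') (at x)"
    using assms by (auto simp: differentiable_def)
  moreover have "f' = (\<lambda>v. \<Sum>i\<in>UNIV. v $ i * partial i f x)"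
    unfolding partial_eq[OF f'] by (rule ext) (rule linear_expand_axis[OF has_derivative_linear[OF f']])
  ultimately show ?thesis by simp
qed

lemma open_line_preimage:
  fixes D :: "'a::real_normed_vector set"
  assumes "open D"
  shows "open {t. x + t *\<^sub>R v \<in> D}"
proof -
  have "open ((\<lambda>t. x + t *\<^sub>R v) -` D)"
    by (rule open_vimage[OF assms]) (intro continuous_intros)
  then show ?thesis by (simp add: vimage_def)
qed

text \<open>The product rule gives the derivative of the gradient scaled by \<open>W x\<close>, plus
  a multiple \<open>l v\<close> of the unnormalised normal. No formula for \<open>l\<close> is kept:
  orthogonality of the normal to its derivative later supplies what is needed.\<close>

lemma has_derivative_graph_normal:
  fixes f :: "real ^ 'n \<Rightarrow> real"
  assumes f2: "\<And>i. partial i f differentiable at x"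
  defines "W \<equiv> \<lambda>y. 1 / sqrt (1 + (\<Sum>i\<in>UNIV. (partial i f y)\<^sup>2))"
  obtains l where "(graph_normal f has_derivative
     (\<lambda>v. W x *\<^sub>R (- (\<chi> i. frechet_derivative (partial i f) (at x) v), 0) +
          l v *\<^sub>R (- (\<chi> i. partial i f x), 1))) (at x)"
proof -
  have d: "(partial i f has_derivative frechet_derivative (partial i f) (at x)) (at x)" for i
    using f2 frechet_derivative_works by blast
  have pos: "0 < 1 + (\<Sum>i\<in>UNIV. (partial i f y)\<^sup>2)" for y
    by (intro add_pos_nonneg sum_nonneg) auto
  have dq: "((\<lambda>y. (\<Sum>i\<in>UNIV. (partial i f y)\<^sup>2)) has_derivative
      (\<lambda>v. (\<Sum>i\<in>UNIV. 2 * partial i f x * frechet_derivative (partial i f) (at x) v))) (at x)"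
    by (rule has_derivative_sum) (auto intro!: derivative_eq_intros d)
  have "\<exists>e. ((\<lambda>s::real. 1 / sqrt (1 + s)) has_field_derivative e) (at (\<Sum>i\<in>UNIV. (partial i f x)\<^sup>2))"
    using pos[of x] by (intro exI) (auto intro!: derivative_eq_intros)
  then obtain l where l: "(W has_derivative l) (at x)"
    unfolding W_def using DERIV_compose_FDERIV[OF _ dq] by blast
  have g: "((\<lambda>y. (- (\<chi> i. partial i f y), 1::real)) has_derivative
      (\<lambda>v. (- (\<chi> i. frechet_derivative (partial i f) (at x) v), 0))) (at x)"
  proof (intro has_derivative_Pair has_derivative_minus has_derivative_const)
    show "((\<lambda>y. \<chi> i. partial i f y) has_derivative
        (\<lambda>v. \<chi> i. frechet_derivative (partial i f) (at x) v)) (at x)"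
      by (rule has_derivative_componentwise_within[THEN iffD2])
         (auto simp: Basis_vec_def inner_axis d)
  qed
  show thesis
    by (rule that[of l])
       (use has_derivative_scaleR[OF l g] in \<open>simp add: graph_normal_def[abs_def] W_def\<close>)
qed

text \<open>
  As the unit normal is orthogonal to its own derivative, the shape operator is minus the horizontal
  part of the derivative of the normal; its kernel is the kernel of the Hessian.
\<close>

lemma GK_curvature_eq_0_iff:
  fixes f :: "real ^ 'n \<Rightarrow> real"
  assumes f1: "f differentiable at x" and f2: "\<And>i. partial i f differentiable at x"
  shows "Gauss_Kronecker_curvature (graph_param f) (graph_normal f) x = 0 \<longleftrightarrow>
    (\<exists>v. v \<noteq> 0 \<and> (\<forall>i. frechet_derivative (partial i f) (at x) v = 0))"
proof -
  define W where "W = (\<lambda>y. 1 / sqrt (1 + (\<Sum>i\<in>UNIV. (partial i f y)\<^sup>2)))"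
  define g where "g = (\<chi> i. partial i f x)"
  define H where "H v = (\<chi> i. frechet_derivative (partial i f) (at x) v)" for v
  have pos: "0 < 1 + (\<Sum>i\<in>UNIV. (partial i f y)\<^sup>2)" for y
    by (intro add_pos_nonneg sum_nonneg) auto
  have W: "0 < W x" using pos[of x] by (simp add: W_def)
  obtain l where l: "(graph_normal f has_derivative
     (\<lambda>v. W x *\<^sub>R (- H v, 0) + l v *\<^sub>R (- g, 1))) (at x)" (is "(_ has_derivative ?N) _")
    by (rule has_derivative_graph_normal[OF f2]) (simp only: W_def g_def H_def)
  have gn: "graph_normal f y = W y *\<^sub>R (- (\<chi> i. partial i f y), 1)" for y
    by (simp add: graph_normal_def W_def)
  have unit: "graph_normal f y \<bullet> graph_normal f y = 1" for y
  proof -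
    have "graph_normal f y \<bullet> graph_normal f y =
        (W y * W y) * (1 + (\<Sum>i\<in>UNIV. (partial i f y)\<^sup>2))"
      unfolding gn by (simp add: inner_vec_def power2_eq_square algebra_simps sum_distrib_left)
    also have "W y * W y = 1 / (1 + (\<Sum>i\<in>UNIV. (partial i f y)\<^sup>2))"
      using pos[of y] by (simp add: W_def)
    finally show ?thesis using pos[of y] by simp
  qed
  have nN: "graph_normal f x \<bullet> ?N v = 0" for v
  proof -
    have "((\<lambda>y. graph_normal f y \<bullet> graph_normal f y) has_derivative
       (\<lambda>v. graph_normal f x \<bullet> ?N v + ?N v \<bullet> graph_normal f x)) (at x)"
      by (rule has_derivative_inner[OF l l])
    moreover have "((\<lambda>y. graph_normal f y \<bullet> graph_normal f y) has_derivative (\<lambda>v. 0)) (at x)"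
      by (simp add: unit)
    ultimately have "(\<lambda>v. graph_normal f x \<bullet> ?N v + ?N v \<bullet> graph_normal f x) = (\<lambda>v. 0)"
      by (rule has_derivative_unique)
    then have "graph_normal f x \<bullet> ?N v + ?N v \<bullet> graph_normal f x = 0" by metis
    then show ?thesis by (simp add: inner_commute)
  qed
  \<comment> \<open>Orthogonality to \<open>(- g, 1)\<close> is tangency to the graph: the last
    component of \<open>- ?N v\<close> is the inner product of \<open>g\<close> with its horizontal
    part, so that part is a valid value of the shape operator.\<close>
  have orth: "g \<bullet> (W x *\<^sub>R H v + l v *\<^sub>R g) + l v = 0" for v
  proof -
    have "W x * (g \<bullet> (W x *\<^sub>R H v + l v *\<^sub>R g) + l v) = 0"
      using nN[of v] by (simp add: gn g_def[symmetric] inner_add_right algebra_simps)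
    with W show ?thesis by simp
  qed
  have df: "(f has_derivative (\<lambda>v. g \<bullet> v)) (at x)"
    using has_derivative_partial[OF f1] by (simp add: g_def inner_vec_def mult.commute)
  have dphi: "frechet_derivative (graph_param f) (at x) = (\<lambda>v. (v, g \<bullet> v))"
    by (rule frechet_derivative_at[symmetric])
       (auto simp: graph_param_def[abs_def] intro!: has_derivative_Pair df)
  have dnu: "frechet_derivative (graph_normal f) (at x) = ?N"
    by (rule frechet_derivative_at[symmetric]) (rule l)
  define S where "S v = W x *\<^sub>R H v + l v *\<^sub>R g" for v
  have linN: "linear ?N" using l by (rule has_derivative_linear)
  have SN: "S v = - fst (?N v)" for v by (simp add: S_def)
  have "linear (\<lambda>v. - fst (?N v))"
    by (intro linear_compose_neg linear_compose[OF linN linear_fst, unfolded o_def])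
  then have linS: "linear S" using SN by presburger
  have S: "shape_operator (graph_param f) (graph_normal f) x = S"
    unfolding shape_operator_def dphi dnu
  proof (rule the_equality)
    show "linear S \<and> (\<forall>v. (S v, g \<bullet> S v) = - ?N v)"
      using linS orth by (auto simp: S_def eq_neg_iff_add_eq_0)
    show "T = S" if "linear T \<and> (\<forall>v. (T v, g \<bullet> T v) = - ?N v)" for T
      using that by (auto simp: S_def fun_eq_iff)
  qed
  have ker: "S v = 0 \<longleftrightarrow> H v = 0" for v
  proof
    assume "S v = 0"
    with orth[of v] have "l v = 0" by (simp add: S_def)
    with \<open>S v = 0\<close> W show "H v = 0" by (simp add: S_def)
  next
    assume H0: "H v = 0"
    with orth[of v] have "l v * (g \<bullet> g + 1) = 0" by (simp add: algebra_simps)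
    moreover have "g \<bullet> g + 1 > 0" by (simp add: add_nonneg_pos)
    ultimately have "l v = 0" by simp
    with H0 show "S v = 0" by (simp add: S_def)
  qed
  have "det (matrix S) = 0 \<longleftrightarrow> (\<exists>v. v \<noteq> 0 \<and> S v = 0)"
  proof -
    have "det (matrix S) = 0 \<longleftrightarrow> \<not> (\<forall>v. matrix S *v v = 0 \<longrightarrow> v = 0)"
      by (simp add: invertible_det_nz flip: invertible_left_inverse matrix_left_invertible_ker)
    then show ?thesis by (auto simp: fun_cong[OF matrix_vector_mul(2)[OF linS]])
  qed
  then show ?thesis
    by (simp add: Gauss_Kronecker_curvature_def S ker) (simp add: H_def vec_eq_iff)
qed

subsection \<open>Regularity of quasi-sums\<close>

lemma strictly_monotone_on_imp_inj_on:
  assumes "strictly_monotone_on A g"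
  shows "inj_on g A"
proof (rule inj_onI)
  fix a b assume "a \<in> A" "b \<in> A" "g a = g b"
  then show "a = b"
    using assms unfolding strictly_monotone_on_def monotone_on_def
    by (metis less_irrefl linorder_neqE_linordered_idom)
qed

text \<open>A one-dimensional inverse function theorem asking for continuity of \<open>k\<close> on
  \<open>S\<close> but for a derivative at \<open>x\<close> alone. It serves to invert
  \<open>F\<close> and the restriction of \<open>u\<close> to an axis.\<close>

lemma DERIV_left_inverse:
  fixes k :: "real \<Rightarrow> real"
  assumes "open S" "x \<in> S" "continuous_on S k" "\<And>z. z \<in> S \<Longrightarrow> g (k z) = z"
    and "(k has_field_derivative d) (at x)" "d \<noteq> 0"
  shows "(g has_field_derivative inverse d) (at (k x))"
  using has_derivative_inverse_strong[OF assms(1-4), of "(*) d" "(*) (inverse d)"] assms(5,6)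
  by (simp add: has_field_derivative_def fun_eq_iff)

lemma DERIV_at_iff_at_0:
  "(g has_field_derivative d) (at a) \<longleftrightarrow> ((\<lambda>t. g (a + t)) has_field_derivative d) (at (0::real))"
  using DERIV_shift[of g d 0 a] by (simp add: add.commute[of a])

lemma axis_1_nth [simp]: "(axis i 1 :: real ^ 'n) $ j = (if j = i then 1 else 0)"
  by (simp add: axis_def)

locale quasi_sum_form =
  fixes D :: "(real ^ 'n) set" and f :: "real ^ 'n \<Rightarrow> real"
    and F :: "real \<Rightarrow> real" and h :: "'n \<Rightarrow> real \<Rightarrow> real" and J :: "real set"
  assumes card_ge_2: "CARD('n) \<ge> 2"
    and domain: "domain_in_orthant D"
    and production: "production_function D f"
    and open_J: "open J"
    and F_mono: "strictly_monotone_on J F"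
    and F_deriv: "\<And>s. s \<in> J \<Longrightarrow> F field_differentiable (at s) \<and> 0 < deriv F s"
    and h_mono: "\<And>i. strictly_monotone_on ((\<lambda>x. x $ i) ` D) (h i)"
    and sum_in_J: "\<And>x. x \<in> D \<Longrightarrow> (\<Sum>i\<in>UNIV. h i (x $ i)) \<in> J"
    and f_eq: "\<And>x. x \<in> D \<Longrightarrow> f x = F (\<Sum>i\<in>UNIV. h i (x $ i))"
begin

definition u :: "real ^ 'n \<Rightarrow> real" where
  "u x = (\<Sum>i\<in>UNIV. h i (x $ i))"

abbreviation "F1 \<equiv> deriv F"
abbreviation "F2 \<equiv> deriv (deriv F)"
abbreviation "h1 \<equiv> \<lambda>i. deriv (h i)"
abbreviation "h2 \<equiv> \<lambda>i. deriv (deriv (h i))"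

lemma open_D: "open D" and connected_D: "connected D" and D_nonempty: "D \<noteq> {}"
  using domain by (auto simp: domain_in_orthant_def)

lemma D_pos: "x \<in> D \<Longrightarrow> 0 < x $ i"
  using domain by (auto simp: domain_in_orthant_def positive_orthant_def)

lemma f_differentiable: "x \<in> D \<Longrightarrow> f differentiable at x"
  and partial_differentiable: "x \<in> D \<Longrightarrow> partial i f differentiable at x"
  and partial_nonzero: "x \<in> D \<Longrightarrow> partial i f x \<noteq> 0"
  using production open_D
  by (auto simp: production_function_def twice_differentiable_on_def differentiable_on_eq_differentiable_at)

lemma u_in_J: "x \<in> D \<Longrightarrow> u x \<in> J"
  using sum_in_J by (simp add: u_def)

lemma f_eq_F_u: "x \<in> D \<Longrightarrow> f x = F (u x)"
  using f_eq by (simp add: u_def)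

lemma F1_pos: "x \<in> D \<Longrightarrow> 0 < F1 (u x)"
  using F_deriv u_in_J by blast

lemma ex_other_index: "\<exists>j. j \<noteq> (i :: 'n)"
proof (rule ccontr)
  assume "\<nexists>j. j \<noteq> i"
  then have "(UNIV :: 'n set) = {i}" by auto
  then have "CARD('n) = 1" by (metis card_1_singleton_iff One_nat_def)
  with card_ge_2 show False by simp
qed

lemma open_line: "open {t. x + t *\<^sub>R axis i 1 \<in> D}"
  by (rule open_line_preimage[OF open_D])

lemma u_axis_line: "u (x + t *\<^sub>R axis i 1) = u x + (h i (x $ i + t) - h i (x $ i))"
proof -
  have "u (x + t *\<^sub>R axis i 1) = h i (x $ i + t) + (\<Sum>j\<in>UNIV - {i}. h j (x $ j))"
    unfolding u_def by (subst sum.remove[of UNIV i]) (auto intro!: sum.cong)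
  moreover have "u x = h i (x $ i) + (\<Sum>j\<in>UNIV - {i}. h j (x $ j))"
    unfolding u_def by (subst sum.remove[of UNIV i]) auto
  ultimately show ?thesis by simp
qed

text \<open>Since the outer function has a differentiable inverse, \<open>u\<close> inherits differentiability from \<open>f\<close>.\<close>

lemma h_has_deriv_aux:
  assumes x: "x \<in> D"
  shows "(h i has_field_derivative partial i f x / F1 (u x)) (at (x $ i))"
proof -
  define G where "G = inv_into J F"
  have inj: "inj_on F J" by (rule strictly_monotone_on_imp_inj_on[OF F_mono])
  have DF: "(F has_field_derivative F1 s) (at s)" if "s \<in> J" for s
    using F_deriv[OF that] by (simp add: DERIV_deriv_iff_field_differentiable)
  have "continuous_on J F"
    using DF by (meson DERIV_isCont continuous_at_imp_continuous_on)
  then have G: "(G has_field_derivative inverse (F1 (u x))) (at (F (u x)))"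
    using DERIV_left_inverse[OF open_J u_in_J[OF x], of F G] inj DF[OF u_in_J[OF x]] F1_pos[OF x]
    by (simp add: G_def)
  have df: "((\<lambda>t. f (x + t *\<^sub>R axis i 1)) has_field_derivative partial i f x) (at 0)"
    using f_differentiable[OF x] deriv_along_line partial_eq by (metis differentiable_def)
  have "((\<lambda>t. G (f (x + t *\<^sub>R axis i 1))) has_field_derivative
      inverse (F1 (u x)) * partial i f x) (at 0)"
    by (rule DERIV_chain2[OF _ df]) (use G in \<open>simp add: f_eq_F_u[OF x]\<close>)
  then have "((\<lambda>t. G (f (x + t *\<^sub>R axis i 1)) + (h i (x $ i) - u x)) has_field_derivative
      inverse (F1 (u x)) * partial i f x) (at 0)"
    by (auto intro!: derivative_eq_intros)
  then have "((\<lambda>t. h i (x $ i + t)) has_field_derivative inverse (F1 (u x)) * partial i f x) (at 0)"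
  proof (rule has_field_derivative_transform_within_open[OF _ open_line[of x i]])
    show "0 \<in> {t. x + t *\<^sub>R axis i 1 \<in> D}" using x by simp
    fix t assume "t \<in> {t. x + t *\<^sub>R axis i 1 \<in> D}"
    then have "G (f (x + t *\<^sub>R axis i 1)) = u (x + t *\<^sub>R axis i 1)"
      using inj by (simp add: f_eq_F_u G_def u_in_J)
    then show "G (f (x + t *\<^sub>R axis i 1)) + (h i (x $ i) - u x) = h i (x $ i + t)"
      by (simp only: u_axis_line)
  qed
  then show ?thesis
    by (simp add: DERIV_at_iff_at_0[of "h i"] divide_inverse mult.commute)
qed

lemma h_has_deriv: "x \<in> D \<Longrightarrow> (h i has_field_derivative h1 i (x $ i)) (at (x $ i))"
  using h_has_deriv_aux DERIV_imp_deriv by metis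

lemma partial_f: "x \<in> D \<Longrightarrow> partial i f x = F1 (u x) * h1 i (x $ i)"
  using DERIV_imp_deriv[OF h_has_deriv_aux] F1_pos by (simp add: less_imp_neq[THEN not_sym])

lemma h1_nonzero: "x \<in> D \<Longrightarrow> h1 i (x $ i) \<noteq> 0"
  using partial_nonzero partial_f by fastforce

lemma u_has_derivative:
  assumes "x \<in> D"
  shows "(u has_derivative (\<lambda>v. \<Sum>i\<in>UNIV. h1 i (x $ i) * v $ i)) (at x)"
proof -
  have "((\<lambda>y. h i (y $ i)) has_derivative (\<lambda>v. v $ i * h1 i (x $ i))) (at x)" for i
    by (rule DERIV_compose_FDERIV[where g = "\<lambda>y. y $ i", OF h_has_deriv[OF assms]])
       (intro bounded_linear_imp_has_derivative bounded_linear_vec_nth)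
  then show ?thesis
    unfolding u_def[abs_def] by (auto intro!: has_derivative_sum simp: mult.commute)
qed

lemma partial_has_deriv_axis_line:
  "x \<in> D \<Longrightarrow> \<exists>d. ((\<lambda>t. partial i f (x + t *\<^sub>R axis j 1)) has_field_derivative d) (at 0)"
  using partial_differentiable deriv_along_line by (metis differentiable_def)

text \<open>In the ratio of the partial derivatives in directions \<open>i\<close> and
  \<open>j\<close> the factor \<open>F1\<close> cancels, leaving \<open>h1 i / h1 j\<close>. Along
  axis \<open>i\<close> the denominator is fixed, so \<open>h1 i\<close> inherits differentiability
  from the first partial derivatives of \<open>f\<close>.\<close>

lemma h1_has_deriv:
  assumes x: "x \<in> D"
  shows "(h1 i has_field_derivative h2 i (x $ i)) (at (x $ i))"
proof -
  obtain j where j: "j \<noteq> i" using ex_other_index by blast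
  let ?q = "\<lambda>t. partial i f (x + t *\<^sub>R axis i 1) / partial j f (x + t *\<^sub>R axis i 1) * h1 j (x $ j)"
  obtain d e where
    d: "((\<lambda>t. partial i f (x + t *\<^sub>R axis i 1)) has_field_derivative d) (at 0)" and
    e: "((\<lambda>t. partial j f (x + t *\<^sub>R axis i 1)) has_field_derivative e) (at 0)"
    using partial_has_deriv_axis_line[OF x] by metis
  have "\<exists>c. (?q has_field_derivative c) (at 0)"
    using partial_nonzero[OF x]
    by (intro exI) (rule DERIV_cmult_right[OF DERIV_divide[OF d e]], simp)
  then obtain c where c: "(?q has_field_derivative c) (at 0)" ..
  have "((\<lambda>t. h1 i (x $ i + t)) has_field_derivative c) (at 0)"
  proof (rule has_field_derivative_transform_within_open[OF c open_line[of x i]])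
    show "0 \<in> {t. x + t *\<^sub>R axis i 1 \<in> D}" using x by simp
    fix t assume "t \<in> {t. x + t *\<^sub>R axis i 1 \<in> D}"
    then have t: "x + t *\<^sub>R axis i 1 \<in> D" by simp
    have "h1 j (x $ j) \<noteq> 0" "F1 (u (x + t *\<^sub>R axis i 1)) \<noteq> 0"
      using h1_nonzero[OF x] F1_pos[OF t] by auto
    then show "?q t = h1 i (x $ i + t)"
      unfolding partial_f[OF t] using j by simp
  qed
  then have "(h1 i has_field_derivative c) (at (x $ i))"
    by (simp add: DERIV_at_iff_at_0[of "h1 i"])
  then show ?thesis by (metis DERIV_imp_deriv)
qed

text \<open>Restricted to an axis, \<open>u\<close> has a differentiable inverse.\<close>

lemma DERIV_through_u:
  assumes x: "x \<in> D"
    and d: "((\<lambda>t. \<phi> (u (x + t *\<^sub>R axis i 1))) has_field_derivative d) (at 0)"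
  shows "(\<phi> has_field_derivative d / h1 i (x $ i)) (at (u x))"
proof -
  define S where "S = {t. x + t *\<^sub>R axis i 1 \<in> D}"
  define k where "k t = u (x + t *\<^sub>R axis i 1)" for t
  define g where "g = inv_into S k"
  have S: "open S" "0 \<in> S" unfolding S_def using open_line x by auto
  have k0: "k 0 = u x" by (simp add: k_def)
  have "continuous_on D u"
    using u_has_derivative has_derivative_continuous continuous_at_imp_continuous_on by blast
  then have cont: "continuous_on S k"
    unfolding k_def S_def by (rule continuous_on_compose2) (auto intro!: continuous_intros)
  have inj: "inj_on k S"
  proof (rule inj_onI)
    fix s t assume st: "s \<in> S" "t \<in> S" "k s = k t"
    have "x $ i + r \<in> (\<lambda>x. x $ i) ` D" if "r \<in> S" for r
      using that by (auto simp: S_def intro!: image_eqI[of _ _ "x + r *\<^sub>R axis i 1"])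
    moreover have "h i (x $ i + s) = h i (x $ i + t)"
      using st(3) by (simp add: k_def u_axis_line)
    ultimately show "s = t"
      using inj_onD[OF strictly_monotone_on_imp_inj_on[OF h_mono[of i]]] st(1,2) by fastforce
  qed
  have "((\<lambda>t. h i (x $ i + t)) has_field_derivative h1 i (x $ i)) (at 0)"
    using h_has_deriv[OF x] by (simp only: flip: DERIV_at_iff_at_0[of "h i"])
  then have dk: "(k has_field_derivative h1 i (x $ i)) (at 0)"
    unfolding k_def u_axis_line by (auto intro!: derivative_eq_intros)
  have dg: "(g has_field_derivative inverse (h1 i (x $ i))) (at (u x))"
    using DERIV_left_inverse[OF S cont _ dk h1_nonzero[OF x], of g] inj by (simp add: g_def k0)
  have "g (u x) = 0" using inj S by (simp add: g_def flip: k0)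
  with d have "((\<lambda>s. \<phi> (k (g s))) has_field_derivative d * inverse (h1 i (x $ i))) (at (u x))"
    unfolding k_def by (intro DERIV_chain2[OF _ dg]) simp
  then have "(\<phi> has_field_derivative d * inverse (h1 i (x $ i))) (at (u x))"
  proof (rule has_field_derivative_transform_within_open)
    \<comment> \<open>Invariance of domain makes the range of \<open>k\<close> a neighbourhood of
      \<open>u x\<close>, so a derivative computed on the range is a genuine two-sided one.\<close>
    show "open (k ` S)" by (rule invariance_of_domain[OF cont S(1) inj])
    show "u x \<in> k ` S" using S k0 by (metis image_eqI)
    show "\<phi> (k (g s)) = \<phi> s" if "s \<in> k ` S" for s
      using that by (simp add: g_def f_inv_into_f)
  qed
  then show ?thesis by (simp add: divide_inverse)
qed

text \<open>Along an axis, \<open>F1\<close> composed with \<open>u\<close> is the quotient of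
  \<open>partial i f\<close> by \<open>h1 i\<close>, both already differentiable;
  \<open>DERIV_through_u\<close> carries this over to \<open>F1\<close> itself.\<close>

lemma F1_has_deriv:
  assumes x: "x \<in> D"
  shows "(F1 has_field_derivative F2 (u x)) (at (u x))"
proof -
  fix i :: 'n
  let ?q = "\<lambda>t. partial i f (x + t *\<^sub>R axis i 1) / h1 i (x $ i + t)"
  obtain d where d: "((\<lambda>t. partial i f (x + t *\<^sub>R axis i 1)) has_field_derivative d) (at 0)"
    using partial_has_deriv_axis_line[OF x] by metis
  have e: "((\<lambda>t. h1 i (x $ i + t)) has_field_derivative h2 i (x $ i)) (at 0)"
    using h1_has_deriv[OF x] by (simp only: flip: DERIV_at_iff_at_0[of "h1 i"])
  have "\<exists>c. (?q has_field_derivative c) (at 0)"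
    using h1_nonzero[OF x] by (intro exI) (rule DERIV_divide[OF d e], simp)
  then obtain c where c: "(?q has_field_derivative c) (at 0)" ..
  have "((\<lambda>t. F1 (u (x + t *\<^sub>R axis i 1))) has_field_derivative c) (at 0)"
  proof (rule has_field_derivative_transform_within_open[OF c open_line[of x i]])
    show "0 \<in> {t. x + t *\<^sub>R axis i 1 \<in> D}" using x by simp
    fix t assume "t \<in> {t. x + t *\<^sub>R axis i 1 \<in> D}"
    then have t: "x + t *\<^sub>R axis i 1 \<in> D" by simp
    show "?q t = F1 (u (x + t *\<^sub>R axis i 1))"
      using h1_nonzero[OF t, of i] unfolding partial_f[OF t] by simp
  qed
  from DERIV_through_u[OF x this] show ?thesis by (metis DERIV_imp_deriv)
qed

section \<open>Second derivatives of a quasi-sum and the kernel of its Hessian\<close>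

lemma h1_has_derivative:
  "x \<in> D \<Longrightarrow> ((\<lambda>y. h1 i (y $ i)) has_derivative (\<lambda>v. v $ i * h2 i (x $ i))) (at x)"
  by (rule DERIV_compose_FDERIV[where g = "\<lambda>y. y $ i", OF h1_has_deriv])
     (auto intro!: bounded_linear_imp_has_derivative bounded_linear_vec_nth)

lemma F1_u_has_derivative:
  "x \<in> D \<Longrightarrow> ((\<lambda>y. F1 (u y)) has_derivative (\<lambda>v. (\<Sum>i\<in>UNIV. h1 i (x $ i) * v $ i) * F2 (u x))) (at x)"
  by (rule DERIV_compose_FDERIV[OF F1_has_deriv u_has_derivative])

lemma partial_f_has_derivative:
  assumes x: "x \<in> D"
  shows "(partial i f has_derivative
     (\<lambda>v. F2 (u x) * h1 i (x $ i) * (\<Sum>j\<in>UNIV. h1 j (x $ j) * v $ j)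
        + F1 (u x) * h2 i (x $ i) * v $ i)) (at x)"
proof (rule has_derivative_transform_within_open[OF _ open_D x])
  show "((\<lambda>y. F1 (u y) * h1 i (y $ i)) has_derivative
     (\<lambda>v. F2 (u x) * h1 i (x $ i) * (\<Sum>j\<in>UNIV. h1 j (x $ j) * v $ j)
        + F1 (u x) * h2 i (x $ i) * v $ i)) (at x)"
    using has_derivative_mult[OF F1_u_has_derivative[OF x] h1_has_derivative[OF x]]
    by (simp add: algebra_simps)
qed (simp add: partial_f)

lemma partial_partial_f:
  assumes x: "x \<in> D"
  shows "partial j (partial i f) x =
    F2 (u x) * h1 i (x $ i) * h1 j (x $ j) + (if j = i then F1 (u x) * h2 i (x $ i) else 0)"
  unfolding partial_eq[OF partial_f_has_derivative[OF x]] by (simp add: axis_def if_distrib cong: if_cong)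

text \<open>The \<open>F2\<close> terms contribute \<open>-1 + 2 - 1\<close> times the same quotient
  \<open>F2 (u x) / (F1 (u x))\<^sup>2\<close> and cancel.\<close>

lemma hicks_denominator_eq:
  assumes x: "x \<in> D" and "i \<noteq> j"
  shows "hicks_denominator f i j x =
    - (h2 i (x $ i) / (h1 i (x $ i))\<^sup>2 + h2 j (x $ j) / (h1 j (x $ j))\<^sup>2) / F1 (u x)"
  using h1_nonzero[OF x] F1_pos[OF x] \<open>i \<noteq> j\<close>
  unfolding hicks_denominator_def partial_partial_f[OF x] partial_f[OF x]
  by (simp add: field_simps power2_eq_square)

lemma hicks_numerator_eq:
  assumes x: "x \<in> D"
  shows "1 / (x $ i * partial i f x) + 1 / (x $ j * partial j f x) =
    (1 / (x $ i * h1 i (x $ i)) + 1 / (x $ j * h1 j (x $ j))) / F1 (u x)"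
proof -
  have "1 / (a * (b * c)) = 1 / (a * c) / b" for a b c :: real by simp
  then show ?thesis unfolding partial_f[OF x] add_divide_distrib by metis
qed

lemma GK_curvature_eq_0_iff_form:
  assumes x: "x \<in> D"
  shows "Gauss_Kronecker_curvature (graph_param f) (graph_normal f) x = 0 \<longleftrightarrow>
    (\<exists>v. v \<noteq> 0 \<and> (\<forall>i. F2 (u x) * h1 i (x $ i) * (\<Sum>j\<in>UNIV. h1 j (x $ j) * v $ j)
        + F1 (u x) * h2 i (x $ i) * v $ i = 0))"
  unfolding GK_curvature_eq_0_iff[OF f_differentiable[OF x] partial_differentiable[OF x]]
    frechet_derivative_at[OF partial_f_has_derivative[OF x], symmetric] ..

end

subsection \<open>Homogeneous functions\<close>

text \<open>Differentiating \<open>f (s *\<^sub>R y) - c = s * (f y - c)\<close> in \<open>y\<close>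
  along an axis produces a factor \<open>s\<close> on both sides, which cancels.\<close>

lemma partial_homogeneous:
  fixes f :: "real ^ 'n \<Rightarrow> real"
  assumes "open D" and hom: "linearly_homogeneous_on D (\<lambda>x. f x - c)"
    and diff: "\<And>x. x \<in> D \<Longrightarrow> f differentiable at x"
    and x: "x \<in> D" and s: "s *\<^sub>R x \<in> D" "s \<noteq> 0"
  shows "partial i f (s *\<^sub>R x) = partial i f x"
proof -
  have dx: "((\<lambda>t. f (x + t *\<^sub>R axis i 1)) has_field_derivative partial i f x) (at 0)" if "x \<in> D" for x
    using diff[OF that] deriv_along_line partial_eq by (metis differentiable_def)
  \<comment> \<open>\<open>D\<close> need not be a cone, so the homogeneity relation is available
    only where both points lie in \<open>D\<close>.\<close>
  define S where "S = {t. x + t *\<^sub>R axis i 1 \<in> D} \<inter> {t. s *\<^sub>R x + t *\<^sub>R (s *\<^sub>R axis i 1) \<in> D}"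
  have "((\<lambda>t. s * (f (x + t *\<^sub>R axis i 1) - c) + c) has_field_derivative s * partial i f x) (at 0)"
    using dx[OF x] by (auto intro!: derivative_eq_intros)
  then have 1: "((\<lambda>t. f (s *\<^sub>R x + t *\<^sub>R (s *\<^sub>R axis i 1))) has_field_derivative s * partial i f x) (at 0)"
  proof (rule has_field_derivative_transform_within_open)
    show "open S"
      unfolding S_def by (intro open_Int open_line_preimage \<open>open D\<close>)
    show "0 \<in> S" using x s by (simp add: S_def)
    fix t assume "t \<in> S"
    moreover have "s *\<^sub>R x + t *\<^sub>R (s *\<^sub>R axis i 1) = s *\<^sub>R (x + t *\<^sub>R axis i 1)"
      by (simp add: algebra_simps)
    ultimately have "f (s *\<^sub>R x + t *\<^sub>R (s *\<^sub>R axis i 1)) - c = s * (f (x + t *\<^sub>R axis i 1) - c)"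
      using hom by (simp only: S_def linearly_homogeneous_on_def Int_iff mem_Collect_eq)
    then show "s * (f (x + t *\<^sub>R axis i 1) - c) + c = f (s *\<^sub>R x + t *\<^sub>R (s *\<^sub>R axis i 1))"
      by simp
  qed
  have "((\<lambda>t. f (s *\<^sub>R x + t *\<^sub>R (s *\<^sub>R axis i 1))) has_field_derivative partial i f (s *\<^sub>R x) * s) (at 0)"
  proof -
    have "((\<lambda>t. f (s *\<^sub>R x + (t * s) *\<^sub>R axis i 1)) has_field_derivative partial i f (s *\<^sub>R x) * s) (at 0)"
      by (rule DERIV_chain2[where g = "\<lambda>t. t * s", of "\<lambda>t. f (s *\<^sub>R x + t *\<^sub>R axis i 1)"])
         (auto simp: dx[OF s(1)] intro!: derivative_eq_intros)
    then show ?thesis by simp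
  qed
  from DERIV_unique[OF 1 this] s(2) show ?thesis by simp
qed

lemma homogeneous_imp_GK_curvature_0:
  fixes f :: "real ^ 'n \<Rightarrow> real"
  assumes "open D" and hom: "linearly_homogeneous_on D (\<lambda>x. f x - c)"
    and f1: "\<And>x. x \<in> D \<Longrightarrow> f differentiable at x"
    and f2: "\<And>i x. x \<in> D \<Longrightarrow> partial i f differentiable at x"
    and x: "x \<in> D" "x \<noteq> 0"
  shows "Gauss_Kronecker_curvature (graph_param f) (graph_normal f) x = 0"
proof -
  have "frechet_derivative (partial i f) (at x) x = 0" for i
  proof (rule DERIV_unique)
    show "((\<lambda>t. partial i f (x + t *\<^sub>R x)) has_field_derivative
        frechet_derivative (partial i f) (at x) x) (at 0)"
      using f2[OF x(1), of i] by (intro deriv_along_line) (simp add: frechet_derivative_works)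
    have "((\<lambda>t. partial i f x) has_field_derivative 0) (at 0)" by simp
    then show "((\<lambda>t. partial i f (x + t *\<^sub>R x)) has_field_derivative 0) (at 0)"
    proof (rule has_field_derivative_transform_within_open)
      \<comment> \<open>The bound \<open>-1 < t\<close> keeps the scaling factor
        \<open>1 + t\<close> away from zero, as \<open>partial_homogeneous\<close> demands.\<close>
      show "open ({t. x + t *\<^sub>R x \<in> D} \<inter> {-1<..})"
        by (intro open_Int open_line_preimage \<open>open D\<close> open_greaterThan)
      show "0 \<in> {t. x + t *\<^sub>R x \<in> D} \<inter> {-1<..}" using x by simp
      fix t assume "t \<in> {t. x + t *\<^sub>R x \<in> D} \<inter> {-1<..}"
      moreover have "x + t *\<^sub>R x = (1 + t) *\<^sub>R x" by (simp add: algebra_simps)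
      ultimately show "partial i f x = partial i f (x + t *\<^sub>R x)"
        using partial_homogeneous[OF \<open>open D\<close> hom f1 x(1), of "1 + t" i] by simp
    qed
  qed
  with x(2) show ?thesis
    using GK_curvature_eq_0_iff[OF f1[OF x(1)] f2[OF x(1)]] by blast
qed

text \<open>Dividing the complex logarithm of \<open>c\<close> by \<open>\<rho>\<close> gives the
  logarithm of a suitable base, also for negative \<open>c\<close>.\<close>

lemma ex_complex_root_real_power:
  assumes "c \<noteq> 0" "\<rho> \<noteq> 0"
  shows "\<exists>a. a \<noteq> 0 \<and> is_real_power a \<rho> c"
proof (intro exI conjI)
  let ?L = "Ln (complex_of_real c) / complex_of_real \<rho>"
  show "exp ?L \<noteq> 0" by simp
  show "is_real_power (exp ?L) \<rho> c"
    unfolding is_real_power_def using assms by (intro exI[of _ ?L]) simp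
qed

section \<open>Linear homogeneity of the ACMS and Cobb-Douglas families\<close>

lemma scale_in_orthant_pos:
  assumes "D \<subseteq> positive_orthant" "x \<in> D" "t *\<^sub>R x \<in> D"
  shows "0 < t"
proof -
  have "0 < x $ i" "0 < t * x $ i" for i
    using assms by (auto simp: positive_orthant_def)
  then show ?thesis by (metis zero_less_mult_pos2)
qed

lemma ACMS_imp_linearly_homogeneous:
  assumes D: "D \<subseteq> positive_orthant" and f: "generalized_ACMS_on D 1 f"
  shows "linearly_homogeneous_on D f"
  unfolding linearly_homogeneous_on_def
proof (intro ballI allI impI)
  fix x t assume x: "x \<in> D" and tx: "t *\<^sub>R x \<in> D"
  obtain \<gamma> \<rho> c where \<rho>: "\<rho> \<noteq> 0"
    and c: "\<And>x. x \<in> D \<Longrightarrow> 0 < (\<Sum>i\<in>UNIV. c i * (x $ i) powr \<rho>) \<and>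
               f x = \<gamma> * (\<Sum>i\<in>UNIV. c i * (x $ i) powr \<rho>) powr (1 / \<rho>)"
    using f unfolding generalized_ACMS_on_def by blast
  have t: "0 < t" by (rule scale_in_orthant_pos[OF D x tx])
  have pos: "0 < x $ i" for i using D x by (auto simp: positive_orthant_def)
  have "(\<Sum>i\<in>UNIV. c i * ((t *\<^sub>R x) $ i) powr \<rho>) = t powr \<rho> * (\<Sum>i\<in>UNIV. c i * (x $ i) powr \<rho>)"
    using t pos by (simp add: powr_mult less_imp_le sum_distrib_left mult_ac)
  then show "f (t *\<^sub>R x) = t * f x"
    using c[OF x] c[OF tx] t \<rho> by (simp add: powr_mult powr_powr less_imp_le)
qed

lemma Cobb_Douglas_imp_linearly_homogeneous:
  assumes D: "D \<subseteq> positive_orthant" and f: "generalized_Cobb_Douglas_on D \<alpha> f"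
    and sum: "(\<Sum>i\<in>UNIV. \<alpha> i) = 1"
  shows "linearly_homogeneous_on D f"
  unfolding linearly_homogeneous_on_def
proof (intro ballI allI impI)
  fix x t assume x: "x \<in> D" and tx: "t *\<^sub>R x \<in> D"
  obtain \<gamma> where \<gamma>: "\<And>x. x \<in> D \<Longrightarrow> f x = \<gamma> * (\<Prod>i\<in>UNIV. (x $ i) powr \<alpha> i)"
    using f unfolding generalized_Cobb_Douglas_on_def by blast
  have t: "0 < t" by (rule scale_in_orthant_pos[OF D x tx])
  have pos: "0 < x $ i" for i using D x by (auto simp: positive_orthant_def)
  have "(\<Prod>i\<in>UNIV. ((t *\<^sub>R x) $ i) powr \<alpha> i) =
      (\<Prod>i\<in>UNIV. t powr \<alpha> i) * (\<Prod>i\<in>UNIV. (x $ i) powr \<alpha> i)"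
    using t pos by (simp add: powr_mult less_imp_le prod.distrib)
  moreover have "(\<Prod>i\<in>UNIV. t powr \<alpha> i) = t"
    using t by (simp add: powr_sum[symmetric] sum)
  ultimately show "f (t *\<^sub>R x) = t * f x"
    by (simp add: \<gamma>[OF x] \<gamma>[OF tx])
qed

text \<open>By the intermediate value theorem the sign is constant. It is recorded as a factor
  \<open>\<epsilon>\<close>, so that logarithms can be taken for both signs at once.\<close>

lemma continuous_nonzero_sign:
  fixes E :: "'a::topological_space \<Rightarrow> real"
  assumes "connected D" "continuous_on D E" "\<And>x. x \<in> D \<Longrightarrow> E x \<noteq> 0"
  obtains \<epsilon> where "\<epsilon> = 1 \<or> \<epsilon> = -1" "\<And>x. x \<in> D \<Longrightarrow> 0 < \<epsilon> * E x"
proof (cases "\<exists>x\<in>D. 0 < E x")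
  case True
  then obtain a where a: "a \<in> D" "0 < E a" by blast
  have "0 < E x" if "x \<in> D" for x
  proof (rule ccontr)
    assume "\<not> 0 < E x"
    then have "0 \<in> E ` D"
      using connectedD_interval[OF connected_continuous_image[OF assms(2,1)], of "E x" "E a" 0]
        a that by auto
    with assms(3) show False by auto
  qed
  then show thesis by (intro that[of 1]) auto
next
  case False
  then have "0 < - E x" if "x \<in> D" for x using assms(3) that by force
  then show thesis by (intro that[of "-1"]) auto
qed

subsection \<open>Constant elasticity of substitution\<close>

context quasi_sum_form
begin

text \<open>Up to the common factor \<open>1 / F1 (u x)\<close>, the Hicks numerator is the sum of
  two values of \<open>p\<close>, and the Hicks denominator is minus the sum of two values of
  \<open>e\<close>, defined next.\<close>

definition p :: "'n \<Rightarrow> real \<Rightarrow> real" where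
  "p i t = 1 / (t * h1 i t)"

definition e :: "'n \<Rightarrow> real \<Rightarrow> real" where
  "e i t = h2 i t / (h1 i t)\<^sup>2"

lemma CES_separated:
  assumes x: "x \<in> D" and "i \<noteq> j" and den: "hicks_denominator f i j x \<noteq> 0"
    and el: "hicks_elasticity f i j x = \<sigma>"
  shows "e i (x $ i) + e j (x $ j) \<noteq> 0"
    and "(p i (x $ i) + \<sigma> * e i (x $ i)) + (p j (x $ j) + \<sigma> * e j (x $ j)) = 0"
proof -
  have d: "hicks_denominator f i j x = - (e i (x $ i) + e j (x $ j)) / F1 (u x)"
    using hicks_denominator_eq[OF x \<open>i \<noteq> j\<close>] by (simp add: e_def)
  then show ne: "e i (x $ i) + e j (x $ j) \<noteq> 0" using den by auto
  have "(p i (x $ i) + p j (x $ j)) / F1 (u x) = \<sigma> * hicks_denominator f i j x"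
    using el den unfolding hicks_elasticity_def hicks_numerator_eq[OF x] p_def
    by (metis nonzero_divide_eq_eq)
  then have "p i (x $ i) + p j (x $ j) = \<sigma> * - (e i (x $ i) + e j (x $ j))"
    using F1_pos[OF x] by (simp add: d field_simps)
  then show "(p i (x $ i) + \<sigma> * e i (x $ i)) + (p j (x $ j) + \<sigma> * e j (x $ j)) = 0"
    by (simp add: algebra_simps)
qed

text \<open>\<open>D\<close> need not be a product, so the coordinates cannot be varied
  independently throughout. Moving coordinate \<open>i\<close> alone by a small amount shows that
  \<open>g i\<close> is locally constant on the projection of \<open>D\<close>, which is
  connected.\<close>

lemma separated_sum_constant:
  assumes sep: "\<And>x. x \<in> D \<Longrightarrow> g i (x $ i) + g j (x $ j) = (0::real)" and "i \<noteq> j"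
    and xy: "x \<in> D" "y \<in> D"
  shows "g i (x $ i) = g i (y $ i)"
proof (rule connected_local_const[where A = "(\<lambda>x. x $ i) ` D" and f = "g i"])
  show "connected ((\<lambda>x. x $ i) ` D)"
    by (intro connected_continuous_image connected_D continuous_intros)
  show "\<forall>a\<in>(\<lambda>x. x $ i) ` D. \<forall>\<^sub>F b in at a within (\<lambda>x. x $ i) ` D. g i a = g i b"
  proof
    fix a assume "a \<in> (\<lambda>x. x $ i) ` D"
    then obtain z where z: "z \<in> D" "a = z $ i" by blast
    have "open ((\<lambda>b. z + (b - a) *\<^sub>R axis i 1) -` D)"
      by (rule open_vimage[OF open_D]) (intro continuous_intros)
    moreover have "g i a = g i b" if "z + (b - a) *\<^sub>R axis i 1 \<in> D" for b
      using sep[OF z(1)] sep[OF that] \<open>i \<noteq> j\<close> z(2) by simp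
    ultimately show "\<forall>\<^sub>F b in at a within (\<lambda>x. x $ i) ` D. g i a = g i b"
      unfolding eventually_at_topological using z(1)
      by (intro exI[of _ "(\<lambda>b. z + (b - a) *\<^sub>R axis i 1) -` D"]) auto
  qed
qed (use xy in auto)

text \<open>The hypothesis on \<open>\<kappa>\<close> eliminates \<open>h2 i\<close>, leaving
  \<open>h1 i\<close> times a polynomial in \<open>p i\<close>; the factor \<open>h1 i\<close>
  disappears on passing to derivatives with respect to \<open>u\<close>.\<close>

lemma p_has_deriv:
  assumes x: "x \<in> D" and "\<sigma> \<noteq> 0" and k: "p i (x $ i) + \<sigma> * e i (x $ i) = \<kappa>"
  shows "(p i has_field_derivative
    h1 i (x $ i) * (p i (x $ i) * ((1 - \<sigma>) * p i (x $ i) - \<kappa>)) / \<sigma>) (at (x $ i))"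
proof -
  let ?t = "x $ i"
  have nz: "?t \<noteq> 0" "h1 i ?t \<noteq> 0" using D_pos[OF x, of i] h1_nonzero[OF x, of i] by auto
  have "\<kappa> * (?t * (h1 i ?t)\<^sup>2) = h1 i ?t + h2 i ?t * (\<sigma> * ?t)"
    unfolding k[symmetric] using nz by (simp add: p_def e_def field_simps power2_eq_square)
  then have *: "h2 i ?t = (\<kappa> * (?t * (h1 i ?t)\<^sup>2) - h1 i ?t) / (\<sigma> * ?t)"
    using nz \<open>\<sigma> \<noteq> 0\<close> by (simp add: eq_divide_eq)
  have "(p i has_field_derivative - (h1 i ?t + ?t * h2 i ?t) / (?t * h1 i ?t)\<^sup>2) (at ?t)"
    unfolding p_def[abs_def] using nz
    by (auto intro!: derivative_eq_intros h1_has_deriv[OF x] simp: power2_eq_square)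
  moreover have "- (h1 i ?t + ?t * h2 i ?t) / (?t * h1 i ?t)\<^sup>2 =
      h1 i ?t * (p i ?t * ((1 - \<sigma>) * p i ?t - \<kappa>)) / \<sigma>"
    unfolding * p_def using nz \<open>\<sigma> \<noteq> 0\<close> by (simp add: field_simps power2_eq_square)
  ultimately show ?thesis by simp
qed

end

subsection \<open>Two inputs with opposite nonzero constants\<close>

text \<open>The values of \<open>g\<close> lie in the finite root set of \<open>q\<close>, and a
  continuous function with finite range on a ball is constant.\<close>

lemma DERIV_eq_0_of_polynomial_relation:
  fixes g :: "real \<Rightarrow> real" and q :: "real poly"
  assumes S: "open S" "0 \<in> S" and cont: "continuous_on S g" and q: "q \<noteq> 0"
    and root: "\<And>t. t \<in> S \<Longrightarrow> poly q (g t) = 0"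
    and d: "(g has_field_derivative d) (at 0)"
  shows "d = 0"
proof -
  obtain r where r: "r > 0" "ball 0 r \<subseteq> S" using S openE by blast
  have "finite (g ` ball 0 r)"
    by (rule finite_subset[OF _ poly_roots_finite[OF q]]) (use root r in auto)
  then have "g constant_on ball 0 r"
    using continuous_finite_range_constant[OF connected_ball continuous_on_subset[OF cont r(2)]] by blast
  then obtain c where c: "\<And>t. t \<in> ball 0 r \<Longrightarrow> g t = c" by (auto simp: constant_on_def)
  have "((\<lambda>t. c) has_field_derivative 0) (at 0)" by simp
  then have "(g has_field_derivative 0) (at 0)"
    by (rule has_field_derivative_transform_within_open[of _ _ _ "ball 0 r"]) (use r c in auto)
  with d show ?thesis by (rule DERIV_unique)
qed

locale two_inputs = quasi_sum_form D f F h J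
  for D :: "(real ^ 'n) set" and f F h J +
  fixes i j :: 'n and \<sigma> \<kappa> :: real
  assumes ij: "i \<noteq> j" and UNIV_eq: "UNIV = {i, j}"
    and \<sigma>: "\<sigma> \<noteq> 0" and \<kappa>: "\<kappa> \<noteq> 0"
    and ode_i: "\<And>x. x \<in> D \<Longrightarrow> p i (x $ i) + \<sigma> * e i (x $ i) = \<kappa>"
    and ode_j: "\<And>x. x \<in> D \<Longrightarrow> p j (x $ j) + \<sigma> * e j (x $ j) = - \<kappa>"
    and e_sum: "\<And>x. x \<in> D \<Longrightarrow> e i (x $ i) + e j (x $ j) \<noteq> 0"
    and curvature: "\<And>x. x \<in> D \<Longrightarrow> Gauss_Kronecker_curvature (graph_param f) (graph_normal f) x = 0"
begin

text \<open>Exchanging the inputs reverses the sign of \<open>\<kappa>\<close>, so every fact about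
  \<open>i\<close> has a mirror image for \<open>j\<close>.\<close>

lemma swap: "two_inputs D f F h J j i \<sigma> (- \<kappa>)"
  using ij UNIV_eq \<sigma> \<kappa> ode_i ode_j e_sum curvature
  by unfold_locales (auto simp: add.commute)

text \<open>In the unknowns \<open>A * v $ i\<close> and \<open>B * v $ j\<close> the kernel
  equations have the matrix with all entries \<open>F2 (u x)\<close> plus \<open>F1 (u x)\<close>
  times the diagonal matrix of the \<open>e\<close> values. The left side is its determinant divided
  by \<open>F1 (u x)\<close>.\<close>

lemma curvature_relation:
  assumes x: "x \<in> D"
  shows "F2 (u x) * (e i (x $ i) + e j (x $ j)) + F1 (u x) * (e i (x $ i) * e j (x $ j)) = 0"
proof -
  define A B where "A = h1 i (x $ i)" and "B = h1 j (x $ j)"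
  have AB: "A \<noteq> 0" "B \<noteq> 0" using h1_nonzero[OF x] by (auto simp: A_def B_def)
  obtain v where v: "v \<noteq> 0" and ker: "\<And>l. F2 (u x) * h1 l (x $ l) * (\<Sum>j\<in>UNIV. h1 j (x $ j) * v $ j)
        + F1 (u x) * h2 l (x $ l) * v $ l = 0"
    using curvature[OF x] GK_curvature_eq_0_iff_form[OF x] by blast
  define s where "s = A * v $ i + B * v $ j"
  have s: "(\<Sum>j\<in>UNIV. h1 j (x $ j) * v $ j) = s"
    unfolding UNIV_eq s_def A_def B_def using ij by simp
  have h2: "h2 l (x $ l) = e l (x $ l) * (h1 l (x $ l))\<^sup>2" for l
    using h1_nonzero[OF x] by (simp add: e_def)
  have "A * (F2 (u x) * s + F1 (u x) * (e i (x $ i) * (A * v $ i))) = 0"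
    using ker[of i] unfolding s h2 by (simp add: A_def algebra_simps power2_eq_square)
  then have 1: "F2 (u x) * s + F1 (u x) * (e i (x $ i) * (A * v $ i)) = 0" using AB by simp
  have "B * (F2 (u x) * s + F1 (u x) * (e j (x $ j) * (B * v $ j))) = 0"
    using ker[of j] unfolding s h2 by (simp add: B_def algebra_simps power2_eq_square)
  then have 2: "F2 (u x) * s + F1 (u x) * (e j (x $ j) * (B * v $ j)) = 0" using AB by simp
  have "s \<noteq> 0"
  proof
    assume s0: "s = 0"
    have "e i (x $ i) * (A * v $ i) = 0" "e j (x $ j) * (B * v $ j) = 0"
      using 1 2 s0 F1_pos[OF x] by auto
    moreover have "A * v $ i = - (B * v $ j)" using s0 by (simp add: s_def)
    moreover have "v $ i \<noteq> 0 \<or> v $ j \<noteq> 0"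
    proof (rule ccontr)
      assume *: "\<not> (v $ i \<noteq> 0 \<or> v $ j \<noteq> 0)"
      have "v $ l = 0" for l using UNIV_eq * UNIV_I[of l] by auto
      then show False using v by (simp add: vec_eq_iff)
    qed
    ultimately have "e i (x $ i) = 0" "e j (x $ j) = 0" using AB by auto
    with e_sum[OF x] show False by simp
  qed
  \<comment> \<open>The crosswise weights give both diagonal terms the coefficient
    \<open>e i (x $ i) * e j (x $ j)\<close>, so that they add up to a multiple of
    \<open>s\<close>.\<close>
  moreover have "s * (F2 (u x) * (e i (x $ i) + e j (x $ j)) + F1 (u x) * (e i (x $ i) * e j (x $ j))) =
      e j (x $ j) * (F2 (u x) * s + F1 (u x) * (e i (x $ i) * (A * v $ i))) +
      e i (x $ i) * (F2 (u x) * s + F1 (u x) * (e j (x $ j) * (B * v $ j)))"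
    by (simp add: s_def algebra_simps)
  ultimately show ?thesis using 1 2 by simp
qed

lemma p_sum:
  assumes x: "x \<in> D"
  shows "p i (x $ i) + p j (x $ j) \<noteq> 0"
proof -
  have "p i (x $ i) + p j (x $ j) = - \<sigma> * (e i (x $ i) + e j (x $ j))"
    using ode_i[OF x] ode_j[OF x] by (simp add: algebra_simps)
  then show ?thesis using e_sum[OF x] \<sigma> by simp
qed

lemma F2_over_F1:
  assumes x: "x \<in> D"
  shows "F2 (u x) / F1 (u x) =
    (p i (x $ i) - \<kappa>) * (p j (x $ j) + \<kappa>) / (\<sigma> * (p i (x $ i) + p j (x $ j)))"
proof -
  let ?p = "p i (x $ i)" and ?q = "p j (x $ j)"
  have e: "e i (x $ i) = (\<kappa> - ?p) / \<sigma>" "e j (x $ j) = - (\<kappa> + ?q) / \<sigma>"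
    using ode_i[OF x] ode_j[OF x] \<sigma> by (auto simp: field_simps)
  have "\<sigma>\<^sup>2 * (F2 (u x) * (e i (x $ i) + e j (x $ j)) + F1 (u x) * (e i (x $ i) * e j (x $ j))) =
      F1 (u x) * ((?p - \<kappa>) * (?q + \<kappa>)) - F2 (u x) * (\<sigma> * (?p + ?q))"
    unfolding e using \<sigma> by (simp add: field_simps power2_eq_square)
  then have "F2 (u x) * (\<sigma> * (?p + ?q)) = F1 (u x) * ((?p - \<kappa>) * (?q + \<kappa>))"
    using curvature_relation[OF x] by simp
  then show ?thesis
    using F1_pos[OF x] p_sum[OF x] \<sigma> by (simp add: frac_eq_eq mult.commute)
qed

text \<open>The right side of \<open>F2_over_F1\<close> is differentiated along axis
  \<open>i\<close>, and division by \<open>h1 i\<close> turns this into a derivative with respect to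
  \<open>u\<close>.\<close>

lemma F2_over_F1_has_deriv:
  assumes x: "x \<in> D"
  shows "((\<lambda>s. F2 s / F1 s) has_field_derivative
    (p j (x $ j) + \<kappa>)\<^sup>2 * (p i (x $ i) * ((1 - \<sigma>) * p i (x $ i) - \<kappa>)) /
    (\<sigma>\<^sup>2 * (p i (x $ i) + p j (x $ j))\<^sup>2)) (at (u x))"
proof -
  define a b where "a = p i (x $ i)" and "b = p j (x $ j)"
  define \<alpha> where "\<alpha> = a * ((1 - \<sigma>) * a - \<kappa>)"
  define \<delta> where "\<delta> = h1 i (x $ i) * \<alpha> / \<sigma>"
  have ab: "a + b \<noteq> 0" using p_sum[OF x] by (simp add: a_def b_def)
  have "((\<lambda>t. p i (x $ i + t)) has_field_derivative \<delta>) (at 0)"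
    using p_has_deriv[OF x \<sigma> ode_i[OF x]] unfolding \<delta>_def \<alpha>_def a_def
    by (simp only: flip: DERIV_at_iff_at_0[of "p i"])
  then have "((\<lambda>t. (p i (x $ i + t) - \<kappa>) * (b + \<kappa>) / (\<sigma> * (p i (x $ i + t) + b)))
      has_field_derivative
      (\<delta> * (b + \<kappa>) * (\<sigma> * (a + b)) - (a - \<kappa>) * (b + \<kappa>) * (\<sigma> * \<delta>)) / ((\<sigma> * (a + b)) * (\<sigma> * (a + b)))) (at 0)"
    using \<sigma> ab by (auto intro!: derivative_eq_intros simp: a_def)
  moreover have "(\<delta> * (b + \<kappa>) * (\<sigma> * (a + b)) - (a - \<kappa>) * (b + \<kappa>) * (\<sigma> * \<delta>)) /
        ((\<sigma> * (a + b)) * (\<sigma> * (a + b))) =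
      h1 i (x $ i) * ((b + \<kappa>)\<^sup>2 * \<alpha> / (\<sigma>\<^sup>2 * (a + b)\<^sup>2))" (is "?n / _ = _")
  proof -
    have \<sigma>\<delta>: "h1 i (x $ i) * \<alpha> = \<sigma> * \<delta>" using \<sigma> by (simp add: \<delta>_def)
    \<comment> \<open>The second factor \<open>b + \<kappa>\<close> arises as
      \<open>(a + b) - (a - \<kappa>)\<close>.\<close>
    have n: "?n = h1 i (x $ i) * \<alpha> * (b + \<kappa>)\<^sup>2"
      unfolding \<sigma>\<delta> by (simp add: algebra_simps power2_eq_square)
    show ?thesis unfolding n by (simp add: power2_eq_square mult_ac)
  qed
  ultimately have "((\<lambda>t. (p i (x $ i + t) - \<kappa>) * (b + \<kappa>) / (\<sigma> * (p i (x $ i + t) + b)))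
      has_field_derivative h1 i (x $ i) * ((b + \<kappa>)\<^sup>2 * \<alpha> / (\<sigma>\<^sup>2 * (a + b)\<^sup>2))) (at 0)"
    by simp
  then have "((\<lambda>t. F2 (u (x + t *\<^sub>R axis i 1)) / F1 (u (x + t *\<^sub>R axis i 1))) has_field_derivative
      h1 i (x $ i) * ((b + \<kappa>)\<^sup>2 * \<alpha> / (\<sigma>\<^sup>2 * (a + b)\<^sup>2))) (at 0)"
  proof (rule has_field_derivative_transform_within_open[OF _ open_line[of x i]])
    show "0 \<in> {t. x + t *\<^sub>R axis i 1 \<in> D}" using x by simp
    fix t assume "t \<in> {t. x + t *\<^sub>R axis i 1 \<in> D}"
    then show "(p i (x $ i + t) - \<kappa>) * (b + \<kappa>) / (\<sigma> * (p i (x $ i + t) + b)) =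
        F2 (u (x + t *\<^sub>R axis i 1)) / F1 (u (x + t *\<^sub>R axis i 1))"
      using F2_over_F1[of "x + t *\<^sub>R axis i 1"] ij by (simp add: b_def)
  qed
  from DERIV_through_u[where \<phi> = "\<lambda>s. F2 s / F1 s", OF x this]
  show ?thesis using h1_nonzero[OF x, of i] by (simp add: a_def b_def \<alpha>_def)
qed

text \<open>The derivative of \<open>F2 / F1\<close> at \<open>u x\<close> is the same whether
  computed along axis \<open>i\<close> or axis \<open>j\<close>; the common nonzero denominator
  cancels.\<close>

lemma balance:
  assumes x: "x \<in> D"
  shows "(p j (x $ j) + \<kappa>)\<^sup>2 * (p i (x $ i) * ((1 - \<sigma>) * p i (x $ i) - \<kappa>)) =
    (p i (x $ i) - \<kappa>)\<^sup>2 * (p j (x $ j) * ((1 - \<sigma>) * p j (x $ j) + \<kappa>))"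
proof -
  interpret swapped: two_inputs D f F h J j i \<sigma> "- \<kappa>" by (rule swap)
  show ?thesis
    using DERIV_unique[OF F2_over_F1_has_deriv[OF x] swapped.F2_over_F1_has_deriv[OF x]] p_sum[OF x] \<sigma>
    by (simp add: add.commute[of "p j (x $ j)" "p i (x $ i)"])
qed

text \<open>
  For fixed \<open>x $ j\<close> the relation \<open>balance\<close> is a polynomial equation for \<open>p i\<close>; either the polynomial
  is zero or \<open>p i\<close> is locally constant.
\<close>

lemma p_critical_or:
  assumes x: "x \<in> D"
  shows "p j (x $ j) = - \<kappa> \<or> (1 - \<sigma>) * p i (x $ i) = \<kappa>"
proof (rule disjCI)
  assume ne: "(1 - \<sigma>) * p i (x $ i) \<noteq> \<kappa>"
  define b where "b = p j (x $ j)"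
  define \<beta> where "\<beta> = b * ((1 - \<sigma>) * b + \<kappa>)"
  \<comment> \<open>The difference of the two sides of \<open>balance\<close>, as a quadratic
    polynomial in the value of \<open>p i\<close> with \<open>p j (x $ j)\<close> held at
    \<open>b\<close>.\<close>
  define q where "q = [: - (\<kappa>\<^sup>2 * \<beta>), 2 * \<kappa> * \<beta> - (b + \<kappa>)\<^sup>2 * \<kappa>, (b + \<kappa>)\<^sup>2 * (1 - \<sigma>) - \<beta> :]"
  define S where "S = {t. x + t *\<^sub>R axis i 1 \<in> D}"
  let ?d = "h1 i (x $ i) * (p i (x $ i) * ((1 - \<sigma>) * p i (x $ i) - \<kappa>)) / \<sigma>"
  have dp: "((\<lambda>t. p i (y $ i + t)) has_field_derivative
      h1 i (y $ i) * (p i (y $ i) * ((1 - \<sigma>) * p i (y $ i) - \<kappa>)) / \<sigma>) (at 0)" if "y \<in> D" for y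
    using p_has_deriv[OF that \<sigma> ode_i[OF that]] by (simp only: flip: DERIV_at_iff_at_0[of "p i"])
  have "?d \<noteq> 0"
    using h1_nonzero[OF x, of i] D_pos[OF x, of i] ne \<sigma> by (auto simp: p_def)
  moreover have "?d = 0" if "q \<noteq> 0"
  proof (rule DERIV_eq_0_of_polynomial_relation[OF _ _ _ that _ dp[OF x]])
    show "open S" "0 \<in> S" using open_line x by (auto simp: S_def)
    show "continuous_on S (\<lambda>t. p i (x $ i + t))"
    proof (rule continuous_at_imp_continuous_on, rule ballI)
      fix t assume "t \<in> S"
      then have t: "x + t *\<^sub>R axis i 1 \<in> D" by (simp add: S_def)
      have "isCont (p i) (x $ i + t)"
        using p_has_deriv[OF t \<sigma> ode_i[OF t]] DERIV_isCont by fastforce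
      then show "isCont (\<lambda>t. p i (x $ i + t)) t"
        by (intro isCont_o2[of _ "\<lambda>t. x $ i + t" "p i"] continuous_intros)
    qed
    fix t assume "t \<in> S"
    then have t: "x + t *\<^sub>R axis i 1 \<in> D" by (simp add: S_def)
    show "poly q (p i (x $ i + t)) = 0"
      using balance[OF t] ij unfolding q_def \<beta>_def b_def
      by (simp add: algebra_simps power2_eq_square)
  qed
  \<comment> \<open>The nonzero derivative rules out a nonzero \<open>q\<close>. The constant
    coefficient then gives \<open>\<beta> = 0\<close>, and the linear one gives
    \<open>b = - \<kappa>\<close>.\<close>
  ultimately have "q = 0" by blast
  then have "\<kappa>\<^sup>2 * \<beta> = 0" "2 * \<kappa> * \<beta> - (b + \<kappa>)\<^sup>2 * \<kappa> = 0" by (auto simp: q_def)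
  then have "b + \<kappa> = 0" using \<kappa> by auto
  then show "p j (x $ j) = - \<kappa>" by (simp add: b_def)
qed

lemma contradiction: False
proof -
  obtain x where x: "x \<in> D" using D_nonempty by blast
  interpret swapped: two_inputs D f F h J j i \<sigma> "- \<kappa>" by (rule swap)
  have 1: "p j (x $ j) = - \<kappa> \<or> (1 - \<sigma>) * p i (x $ i) = \<kappa>" by (rule p_critical_or[OF x])
  have 2: "p i (x $ i) = \<kappa> \<or> (1 - \<sigma>) * p j (x $ j) = - \<kappa>" using swapped.p_critical_or[OF x] by simp
  \<comment> \<open>The first alternative of one fact is incompatible with both alternatives of the
    other: with the first by \<open>p_sum\<close>, with the second by these inequalities. Hence both
    second alternatives hold.\<close>
  have "(1 - \<sigma>) * \<kappa> \<noteq> \<kappa>" using \<sigma> \<kappa> by (simp add: algebra_simps)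
  moreover have "(1 - \<sigma>) * - \<kappa> \<noteq> - \<kappa>" using \<sigma> \<kappa> by (simp add: algebra_simps)
  ultimately have "(1 - \<sigma>) * p i (x $ i) = \<kappa>" "(1 - \<sigma>) * p j (x $ j) = - \<kappa>"
    using 1 2 p_sum[OF x] by (metis add.right_inverse)+
  then have "(1 - \<sigma>) * (p i (x $ i) + p j (x $ j)) = 0" by (simp add: distrib_left)
  then have "1 - \<sigma> = 0" using p_sum[OF x] by simp
  then show False using \<open>(1 - \<sigma>) * p i (x $ i) = \<kappa>\<close> \<kappa> by simp
qed

end

subsection \<open>Inputs with vanishing constants\<close>

locale balanced_inputs = quasi_sum_form D f F h J
  for D :: "(real ^ 'n) set" and f F h J +
  fixes \<sigma> :: real
  assumes \<sigma>: "\<sigma> \<noteq> 0"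
    and ode: "\<And>x i. x \<in> D \<Longrightarrow> p i (x $ i) + \<sigma> * e i (x $ i) = 0"
    and curvature: "\<And>x. x \<in> D \<Longrightarrow> Gauss_Kronecker_curvature (graph_param f) (graph_normal f) x = 0"
begin

definition E :: "real ^ 'n \<Rightarrow> real" where
  "E x = (\<Sum>i\<in>UNIV. x $ i * h1 i (x $ i))"

lemma h2_eq:
  assumes x: "x \<in> D"
  shows "\<sigma> * (x $ i * h2 i (x $ i)) = - h1 i (x $ i)"
proof -
  have nz: "x $ i \<noteq> 0" "h1 i (x $ i) \<noteq> 0" using D_pos[OF x, of i] h1_nonzero[OF x, of i] by auto
  have "(p i (x $ i) + \<sigma> * e i (x $ i)) * (x $ i * (h1 i (x $ i))\<^sup>2) =
      h1 i (x $ i) + \<sigma> * (x $ i * h2 i (x $ i))"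
    using nz by (simp add: p_def e_def field_simps power2_eq_square)
  then show ?thesis using ode[OF x, of i] by simp
qed

text \<open>Substituting \<open>h2_eq\<close> into the kernel equations forces \<open>v\<close> to
  be a multiple of \<open>x\<close>. Inserting this multiple into the definition of \<open>s\<close>
  leaves one scalar relation.\<close>

lemma F1_eq:
  assumes x: "x \<in> D"
  shows "F1 (u x) = \<sigma> * F2 (u x) * E x"
proof -
  obtain v where v: "v \<noteq> 0" and ker: "\<And>i. F2 (u x) * h1 i (x $ i) * (\<Sum>j\<in>UNIV. h1 j (x $ j) * v $ j)
        + F1 (u x) * h2 i (x $ i) * v $ i = 0"
    using curvature[OF x] GK_curvature_eq_0_iff_form[OF x] by blast
  define s where "s = (\<Sum>j\<in>UNIV. h1 j (x $ j) * v $ j)"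
  have vi: "F1 (u x) * v $ i = \<sigma> * F2 (u x) * s * x $ i" for i
  proof -
    have "h1 i (x $ i) * (\<sigma> * F2 (u x) * s * x $ i - F1 (u x) * v $ i) =
        \<sigma> * x $ i * (F2 (u x) * h1 i (x $ i) * s) - h1 i (x $ i) * (F1 (u x) * v $ i)"
      by (simp add: algebra_simps)
    also have "\<dots> = \<sigma> * x $ i * (F2 (u x) * h1 i (x $ i) * s + F1 (u x) * h2 i (x $ i) * v $ i)"
      using h2_eq[OF x, of i] by (simp add: algebra_simps)
    also have "\<dots> = 0" using ker[of i] by (simp add: s_def)
    finally show ?thesis using h1_nonzero[OF x, of i] by simp
  qed
  have "s \<noteq> 0"
  proof
    assume "s = 0"
    then have "v $ i = 0" for i using vi[of i] F1_pos[OF x] by simp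
    then show False using v by (simp add: vec_eq_iff)
  qed
  have "F1 (u x) * s = (\<Sum>i\<in>UNIV. h1 i (x $ i) * (F1 (u x) * v $ i))"
    by (simp add: s_def sum_distrib_left mult_ac)
  also have "\<dots> = \<sigma> * F2 (u x) * E x * s"
    unfolding vi by (simp add: E_def sum_distrib_left sum_distrib_right mult_ac)
  finally show ?thesis using \<open>s \<noteq> 0\<close> by simp
qed

lemma E_nonzero: "x \<in> D \<Longrightarrow> E x \<noteq> 0"
  using F1_eq F1_pos by fastforce

text \<open>By \<open>h2_eq\<close>, the derivative of \<open>t * h1 i t\<close> is
  \<open>(1 - 1 / \<sigma>) * h1 i t\<close>, so the derivative of \<open>E\<close> is a constant
  multiple of that of \<open>u\<close>.\<close>

lemma E_has_derivative:
  assumes x: "x \<in> D"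
  shows "(E has_derivative (\<lambda>v. (1 - 1 / \<sigma>) * (\<Sum>i\<in>UNIV. h1 i (x $ i) * v $ i))) (at x)"
proof -
  have "((\<lambda>y. y $ i * h1 i (y $ i)) has_derivative
      (\<lambda>v. (1 - 1 / \<sigma>) * (h1 i (x $ i) * v $ i))) (at x)" for i
  proof -
    have "x $ i * (v $ i * h2 i (x $ i)) + v $ i * h1 i (x $ i) =
        (1 - 1 / \<sigma>) * (h1 i (x $ i) * v $ i)" for v :: "real ^ 'n"
    proof -
      have "x $ i * h2 i (x $ i) = - h1 i (x $ i) / \<sigma>"
        using h2_eq[OF x, of i] \<sigma> by (metis nonzero_mult_div_cancel_left)
      then have "x $ i * (v $ i * h2 i (x $ i)) = v $ i * (- h1 i (x $ i) / \<sigma>)"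
        by (metis mult.left_commute)
      then show ?thesis by (simp add: algebra_simps)
    qed
    moreover have "((\<lambda>y. y $ i * h1 i (y $ i)) has_derivative
        (\<lambda>v. x $ i * (v $ i * h2 i (x $ i)) + v $ i * h1 i (x $ i))) (at x)"
      by (rule has_derivative_mult[OF _ h1_has_derivative[OF x]])
         (intro bounded_linear_imp_has_derivative bounded_linear_vec_nth)
    ultimately show ?thesis by simp
  qed
  then show ?thesis
    unfolding E_def[abs_def] sum_distrib_left by (intro has_derivative_sum)
qed

lemma f_has_derivative:
  assumes x: "x \<in> D"
  shows "(f has_derivative (\<lambda>v. F1 (u x) * (\<Sum>i\<in>UNIV. h1 i (x $ i) * v $ i))) (at x)"
  using has_derivative_partial[OF f_differentiable[OF x]] unfolding partial_f[OF x]
  by (simp add: sum_distrib_left mult_ac)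

text \<open>This is Euler's relation for \<open>f - c\<close>, since \<open>E x * F1 (u x)\<close> is the radial derivative of \<open>f\<close>.\<close>

lemma f_minus_const:
  obtains c where "\<And>x. x \<in> D \<Longrightarrow> f x - c = E x * F1 (u x)"
proof -
  have d: "((\<lambda>y. f y - E y * F1 (u y)) has_derivative (\<lambda>v. 0)) (at x)" if x: "x \<in> D" for x
  proof -
    have "F1 (u x) * s - (E x * (s * F2 (u x)) + (1 - 1 / \<sigma>) * s * F1 (u x)) = 0" for s
    proof -
      have "E x * (s * F2 (u x)) = s * F1 (u x) / \<sigma>"
        using F1_eq[OF x] \<sigma> by (simp add: mult_ac)
      then show ?thesis by (simp add: algebra_simps)
    qed
    with has_derivative_diff[OF f_has_derivative[OF x]
        has_derivative_mult[OF E_has_derivative[OF x] F1_u_has_derivative[OF x]]]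
    show ?thesis by simp
  qed
  obtain a where a: "a \<in> D" using D_nonempty by blast
  show thesis
  proof (rule that[of "f a - E a * F1 (u a)"])
    fix x assume "x \<in> D"
    then have "f x - E x * F1 (u x) = f a - E a * F1 (u a)"
      using has_derivative_zero_unique_connected[OF open_D connected_D d _ a] by blast
    then show "f x - (f a - E a * F1 (u a)) = E x * F1 (u x)" by simp
  qed
qed

text \<open>\<open>h2_eq\<close> is a linear differential equation for \<open>h1 i\<close> with
  integrating factor \<open>t powr (1 / \<sigma>)\<close>. The product is viewed as a function on
  \<open>D\<close>, whose connectedness makes it constant.\<close>

lemma h1_power:
  obtains b where "\<And>i. b i \<noteq> 0" "\<And>x i. x \<in> D \<Longrightarrow> h1 i (x $ i) = b i * (x $ i) powr (- 1 / \<sigma>)"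
proof -
  define m where "m i x = (x $ i) powr (1 / \<sigma>) * h1 i (x $ i)" for i and x :: "real ^ 'n"
  have d: "(m i has_derivative (\<lambda>v. 0)) (at x)" if x: "x \<in> D" for x i
  proof -
    let ?t = "x $ i"
    have t: "0 < ?t" using D_pos[OF x] .
    have "((\<lambda>t. t powr (1 / \<sigma>) * h1 i t) has_field_derivative
        (1 / \<sigma>) * ?t powr (1 / \<sigma> - 1) * h1 i ?t + h2 i ?t * ?t powr (1 / \<sigma>)) (at ?t)"
      using t by (intro DERIV_mult has_real_derivative_powr h1_has_deriv[OF x])
    moreover have "(1 / \<sigma>) * ?t powr (1 / \<sigma> - 1) * h1 i ?t + h2 i ?t * ?t powr (1 / \<sigma>) = 0"
    proof -
      have "h2 i ?t * (\<sigma> * ?t) = - h1 i ?t"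
        using h2_eq[OF x, of i] by (simp only: mult_ac)
      moreover have "\<sigma> * ?t \<noteq> 0" using \<sigma> t by simp
      ultimately have h2: "h2 i ?t = - h1 i ?t / (\<sigma> * ?t)"
        by (metis nonzero_mult_div_cancel_right)
      have "?t powr (1 / \<sigma> - 1) = ?t powr (1 / \<sigma>) / ?t"
        using t by (simp add: powr_diff)
      then show ?thesis unfolding h2 by simp
    qed
    ultimately have "((\<lambda>t. t powr (1 / \<sigma>) * h1 i t) has_field_derivative 0) (at ?t)" by simp
    from DERIV_compose_FDERIV[where g = "\<lambda>y. y $ i", OF this
        bounded_linear_imp_has_derivative[OF bounded_linear_vec_nth]]
    show ?thesis by (simp add: m_def[abs_def])
  qed
  obtain a where a: "a \<in> D" using D_nonempty by blast
  have const: "m i x = m i a" if "x \<in> D" for x i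
    using has_derivative_zero_unique_connected[OF open_D connected_D d that a] .
  show thesis
  proof (rule that[of "\<lambda>i. m i a"])
    show "m i a \<noteq> 0" for i
      using h1_nonzero[OF a, of i] D_pos[OF a, of i] by (simp add: m_def)
    fix x i assume x: "x \<in> D"
    have "(x $ i) powr (1 / \<sigma>) * (x $ i) powr (- 1 / \<sigma>) = 1"
      using D_pos[OF x, of i] by (simp flip: powr_add)
    then have "h1 i (x $ i) = m i x * (x $ i) powr (- 1 / \<sigma>)"
      by (simp add: m_def mult_ac)
    then show "h1 i (x $ i) = m i a * (x $ i) powr (- 1 / \<sigma>)"
      by (simp only: const[OF x])
  qed
qed

text \<open>By Euler's relation the logarithmic derivative of \<open>f - c\<close> is the derivative
  of \<open>u\<close> divided by \<open>E\<close>, so \<open>N\<close> differs from the logarithm by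
  a constant \<open>m\<close>. As \<open>F1\<close> is positive, \<open>f - c\<close> has the sign
  of \<open>E\<close>.\<close>

lemma log_integration:
  assumes c: "\<And>x. x \<in> D \<Longrightarrow> f x - c = E x * F1 (u x)"
    and \<epsilon>: "\<And>x. x \<in> D \<Longrightarrow> 0 < \<epsilon> * E x"
    and N: "\<And>x. x \<in> D \<Longrightarrow> (N has_derivative (\<lambda>v. (\<Sum>i\<in>UNIV. h1 i (x $ i) * v $ i) / E x)) (at x)"
  obtains m where "\<And>x. x \<in> D \<Longrightarrow> \<epsilon> * (f x - c) = exp m * exp (N x)"
proof -
  have pos: "0 < \<epsilon> * (f x - c)" if "x \<in> D" for x
  proof -
    have "\<epsilon> * (f x - c) = (\<epsilon> * E x) * F1 (u x)" by (simp add: c[OF that])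
    also have "0 < \<dots>" using \<epsilon>[OF that] F1_pos[OF that] by simp
    finally show ?thesis .
  qed
  have d: "((\<lambda>y. ln (\<epsilon> * (f y - c)) - N y) has_derivative (\<lambda>v. 0)) (at x)" if x: "x \<in> D" for x
  proof -
    have "((\<lambda>y. \<epsilon> * (f y - c)) has_derivative
        (\<lambda>v. \<epsilon> * (F1 (u x) * (\<Sum>i\<in>UNIV. h1 i (x $ i) * v $ i)))) (at x)"
      by (auto intro!: derivative_eq_intros f_has_derivative[OF x])
    from DERIV_compose_FDERIV[OF DERIV_ln_divide[OF pos[OF x]] this]
    have "((\<lambda>y. ln (\<epsilon> * (f y - c))) has_derivative
        (\<lambda>v. \<epsilon> * (F1 (u x) * (\<Sum>i\<in>UNIV. h1 i (x $ i) * v $ i)) * (1 / (\<epsilon> * (f x - c))))) (at x)" .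
    moreover have "\<epsilon> * (F1 (u x) * s) * (1 / (\<epsilon> * (f x - c))) = s / E x" for s
      unfolding c[OF x] using F1_pos[OF x] \<epsilon>[OF x] by (auto simp: field_simps)
    ultimately have "((\<lambda>y. ln (\<epsilon> * (f y - c))) has_derivative
        (\<lambda>v. (\<Sum>i\<in>UNIV. h1 i (x $ i) * v $ i) / E x)) (at x)" by simp
    from has_derivative_diff[OF this N[OF x]] show ?thesis by simp
  qed
  obtain a where a: "a \<in> D" using D_nonempty by blast
  show thesis
  proof (rule that[of "ln (\<epsilon> * (f a - c)) - N a"])
    fix x assume x: "x \<in> D"
    have "ln (\<epsilon> * (f x - c)) - N x = ln (\<epsilon> * (f a - c)) - N a"
      using has_derivative_zero_unique_connected[OF open_D connected_D d x a] .
    then have "exp (ln (\<epsilon> * (f a - c)) - N a) * exp (N x) = exp (ln (\<epsilon> * (f x - c)))"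
      by (metis diff_add_cancel exp_add)
    then show "\<epsilon> * (f x - c) = exp (ln (\<epsilon> * (f a - c)) - N a) * exp (N x)"
      using pos[OF x] by simp
  qed
qed

lemma ACMS_or_Cobb_Douglas:
  "\<exists>c. generalized_ACMS_on D 1 (\<lambda>x. f x - c) \<or>
    (\<exists>\<alpha>. generalized_Cobb_Douglas_on D \<alpha> (\<lambda>x. f x - c) \<and> (\<Sum>i\<in>UNIV. \<alpha> i) = 1)"
proof -
  obtain c where c: "\<And>x. x \<in> D \<Longrightarrow> f x - c = E x * F1 (u x)" using f_minus_const by blast
  obtain b where b: "\<And>i. b i \<noteq> 0"
    and h1_b: "\<And>x i. x \<in> D \<Longrightarrow> h1 i (x $ i) = b i * (x $ i) powr (- 1 / \<sigma>)"
    using h1_power by blast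
  have "continuous_on D E"
    using E_has_derivative has_derivative_continuous continuous_at_imp_continuous_on by blast
  from continuous_nonzero_sign[OF connected_D this E_nonzero]
  obtain \<epsilon> where \<epsilon>: "\<epsilon> = 1 \<or> \<epsilon> = -1" and pos: "\<And>x. x \<in> D \<Longrightarrow> 0 < \<epsilon> * E x" by blast
  define \<rho> where "\<rho> = 1 - 1 / \<sigma>"
  have E_b: "E x = (\<Sum>i\<in>UNIV. b i * (x $ i) powr \<rho>)" if x: "x \<in> D" for x
    unfolding E_def
  proof (rule sum.cong)
    fix i
    have "x $ i * (x $ i) powr (- 1 / \<sigma>) = (x $ i) powr \<rho>"
      using D_pos[OF x, of i] by (simp add: \<rho>_def powr_diff powr_minus_divide)
    then show "x $ i * h1 i (x $ i) = b i * (x $ i) powr \<rho>"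
      unfolding h1_b[OF x] by simp
  qed simp
  show ?thesis
  proof (cases "\<rho> = 0")
    case False
    \<comment> \<open>This is the required antiderivative because the derivative of \<open>E\<close>
      is \<open>\<rho>\<close> times that of \<open>u\<close>.\<close>
    have N: "((\<lambda>y. ln (\<epsilon> * E y) / \<rho>) has_derivative
        (\<lambda>v. (\<Sum>i\<in>UNIV. h1 i (x $ i) * v $ i) / E x)) (at x)" if x: "x \<in> D" for x
    proof -
      have "((\<lambda>y. \<epsilon> * E y) has_derivative
          (\<lambda>v. \<epsilon> * ((1 - 1 / \<sigma>) * (\<Sum>i\<in>UNIV. h1 i (x $ i) * v $ i)))) (at x)"
        by (auto intro!: derivative_eq_intros E_has_derivative[OF x])
      from bounded_linear.has_derivative[OF bounded_linear_divide[of \<rho>]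
          DERIV_compose_FDERIV[OF DERIV_ln_divide[OF pos[OF x]] this]]
      have "((\<lambda>y. ln (\<epsilon> * E y) / \<rho>) has_derivative
        (\<lambda>v. \<epsilon> * (\<rho> * (\<Sum>i\<in>UNIV. h1 i (x $ i) * v $ i)) * (1 / (\<epsilon> * E x)) / \<rho>)) (at x)"
        by (simp add: \<rho>_def)
      moreover have "\<epsilon> * (\<rho> * s) * (1 / (\<epsilon> * E x)) / \<rho> = s / E x" for s
        using False pos[OF x] by (auto simp: field_simps)
      ultimately show ?thesis by simp
    qed
    obtain m where m: "\<And>x. x \<in> D \<Longrightarrow> \<epsilon> * (f x - c) = exp m * exp (ln (\<epsilon> * E x) / \<rho>)"
      using log_integration[OF c pos N] by blast
    \<comment> \<open>The coefficients are \<open>\<epsilon> * b i\<close> rather than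
      \<open>b i\<close>, since the power sum, then equal to \<open>\<epsilon> * E x\<close>, has to
      be positive.\<close>
    have "\<forall>i. \<exists>a. a \<noteq> 0 \<and> is_real_power a \<rho> (\<epsilon> * b i)"
      using ex_complex_root_real_power False b \<epsilon> by fastforce
    then obtain a where a: "\<And>i. a i \<noteq> 0 \<and> is_real_power (a i) \<rho> (\<epsilon> * b i)" by metis
    have sum: "(\<Sum>i\<in>UNIV. \<epsilon> * b i * (x $ i) powr \<rho>) = \<epsilon> * E x" if "x \<in> D" for x
      by (simp add: E_b[OF that] sum_distrib_left mult.assoc)
    have "f x - c = \<epsilon> * exp m * (\<epsilon> * E x) powr (1 / \<rho>)" if x: "x \<in> D" for x
    proof -
      have "f x - c = \<epsilon> * (\<epsilon> * (f x - c))" using \<epsilon> by auto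
      also have "\<dots> = \<epsilon> * (exp m * exp (ln (\<epsilon> * E x) / \<rho>))" unfolding m[OF x] ..
      also have "exp (ln (\<epsilon> * E x) / \<rho>) = (\<epsilon> * E x) powr (1 / \<rho>)"
        using pos[OF x] by (auto simp: powr_def)
      finally show ?thesis by simp
    qed
    then have "generalized_ACMS_on D 1 (\<lambda>x. f x - c)"
      unfolding generalized_ACMS_on_def using \<epsilon> False a pos
      by (intro exI[of _ "\<epsilon> * exp m"] exI[of _ \<rho>] exI[of _ a] exI[of _ "\<lambda>i. \<epsilon> * b i"])
         (auto simp: sum)
    then show ?thesis by blast
  next
    case True
    then have \<sigma>1: "\<sigma> = 1" by (simp add: \<rho>_def)
    \<comment> \<open>For \<open>\<rho> = 0\<close> every power in \<open>E_b\<close> equals one, so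
      \<open>E\<close> is the constant \<open>B\<close>. Division by \<open>B\<close> yields
      exponents with sum one.\<close>
    define B where "B = (\<Sum>i\<in>UNIV. b i)"
    have E_B: "E x = B" if "x \<in> D" for x
      unfolding E_b[OF that] B_def True using D_pos[OF that] by (simp add: less_imp_neq[THEN not_sym])
    have B: "B \<noteq> 0" using D_nonempty E_B E_nonzero by fastforce
    have N: "((\<lambda>y. \<Sum>i\<in>UNIV. b i / B * ln (y $ i)) has_derivative
        (\<lambda>v. (\<Sum>i\<in>UNIV. h1 i (x $ i) * v $ i) / E x)) (at x)" if x: "x \<in> D" for x
    proof -
      have "((\<lambda>y. b i / B * ln (y $ i)) has_derivative (\<lambda>v. h1 i (x $ i) * v $ i / B)) (at x)" for i
      proof -
        have "((\<lambda>y. ln (y $ i)) has_derivative (\<lambda>v. v $ i * (1 / x $ i))) (at x)"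
          by (rule DERIV_compose_FDERIV[where g = "\<lambda>y. y $ i", OF DERIV_ln_divide[OF D_pos[OF x]]])
             (intro bounded_linear_imp_has_derivative bounded_linear_vec_nth)
        from has_derivative_mult_right[OF this, of "b i / B"] show ?thesis
          unfolding h1_b[OF x] \<sigma>1 using D_pos[OF x, of i]
          by (simp add: powr_minus_divide mult_ac)
      qed
      then show ?thesis
        unfolding E_B[OF x] sum_divide_distrib by (intro has_derivative_sum)
    qed
    obtain m where m: "\<And>x. x \<in> D \<Longrightarrow> \<epsilon> * (f x - c) = exp m * exp (\<Sum>i\<in>UNIV. b i / B * ln (x $ i))"
      using log_integration[OF c pos N] by blast
    have "f x - c = \<epsilon> * exp m * (\<Prod>i\<in>UNIV. (x $ i) powr (b i / B))" if x: "x \<in> D" for x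
    proof -
      have "f x - c = \<epsilon> * (\<epsilon> * (f x - c))" using \<epsilon> by auto
      also have "\<dots> = \<epsilon> * (exp m * exp (\<Sum>i\<in>UNIV. b i / B * ln (x $ i)))" unfolding m[OF x] ..
      also have "exp (\<Sum>i\<in>UNIV. b i / B * ln (x $ i)) = (\<Prod>i\<in>UNIV. (x $ i) powr (b i / B))"
        unfolding exp_sum[OF finite_class.finite_UNIV]
      proof (rule prod.cong)
        show "exp (b i / B * ln (x $ i)) = (x $ i) powr (b i / B)" for i
          using D_pos[OF x, of i] by (simp add: powr_def)
      qed simp
      finally show ?thesis by simp
    qed
    then have "generalized_Cobb_Douglas_on D (\<lambda>i. b i / B) (\<lambda>x. f x - c)"
      unfolding generalized_Cobb_Douglas_on_def using b B \<epsilon>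
      by (auto intro!: exI[of _ "\<epsilon> * exp m"])
    moreover have "(\<Sum>i\<in>UNIV. b i / B) = 1"
      using B by (simp add: B_def flip: sum_divide_distrib)
    ultimately show ?thesis by blast
  qed
qed

end

subsection \<open>The classification\<close>

theorem theorem4p1:
  fixes D :: "(real ^ 'n) set" and f :: "real ^ 'n \<Rightarrow> real"
  assumes "CARD('n) \<ge> 2"
    and "domain_in_orthant D"
    and "production_function D f"
    and "quasi_sum D f"
    and "CES_property D f"
  shows "graph_has_vanishing_GK_curvature D f \<longleftrightarrow>
    (\<exists>c. (linearly_homogeneous_on D (\<lambda>x. f x - c) \<and> generalized_ACMS_on D 1 (\<lambda>x. f x - c)) \<or>
         (\<exists>\<alpha>. linearly_homogeneous_on D (\<lambda>x. f x - c) \<and>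
              generalized_Cobb_Douglas_on D \<alpha> (\<lambda>x. f x - c) \<and> (\<Sum>i\<in>UNIV. \<alpha> i) = 1))"
proof -
  obtain F h J where "quasi_sum_form D f F h J"
    using assms(1-4) unfolding quasi_sum_def quasi_sum_form_def by blast
  then interpret quasi_sum_form D f F h J .
  have orthant: "D \<subseteq> positive_orthant" using assms(2) by (simp add: domain_in_orthant_def)
  obtain \<sigma> where \<sigma>: "\<sigma> \<noteq> 0" and ces: "\<forall>x\<in>D. \<forall>i j. i \<noteq> j \<longrightarrow>
      hicks_denominator f i j x \<noteq> 0 \<and> hicks_elasticity f i j x = \<sigma>"
    using assms(5) unfolding CES_property_def by (elim exE conjE)
  define g where "g i t = p i t + \<sigma> * e i t" for i t
  have g_sum: "g i (x $ i) + g j (x $ j) = 0" if "x \<in> D" "i \<noteq> j" for x i j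
    using CES_separated(2)[OF that] ces that by (simp add: g_def)
  have e_sum: "e i (x $ i) + e j (x $ j) \<noteq> 0" if "x \<in> D" "i \<noteq> j" for x i j
    using CES_separated(1)[OF that] ces that by simp
  obtain a where a: "a \<in> D" using D_nonempty by blast
  define \<kappa> where "\<kappa> i = g i (a $ i)" for i
  have g_const: "g i (x $ i) = \<kappa> i" if x: "x \<in> D" for x i
  proof -
    obtain j where "i \<noteq> j" using ex_other_index by metis
    then show ?thesis
      unfolding \<kappa>_def by (intro separated_sum_constant[of g i j x a] g_sum x a)
  qed
  have \<kappa>_sum: "\<kappa> i + \<kappa> j = 0" if "i \<noteq> j" for i j
    using g_sum[OF a that] by (simp add: \<kappa>_def)
  show ?thesis
  proof
    assume "graph_has_vanishing_GK_curvature D f"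
    then have curv: "Gauss_Kronecker_curvature (graph_param f) (graph_normal f) x = 0" if "x \<in> D" for x
      using that by (simp add: graph_has_vanishing_GK_curvature_def)
    have "\<kappa> i = 0" for i
    proof (rule ccontr)
      assume i: "\<kappa> i \<noteq> 0"
      obtain j where j: "j \<noteq> i" using ex_other_index by blast
      have \<kappa>j: "\<kappa> j = - \<kappa> i" using \<kappa>_sum[OF j] by simp
      \<comment> \<open>The constant of a third index would be opposite to both
        \<open>\<kappa> i\<close> and \<open>- \<kappa> i\<close>, forcing
        \<open>\<kappa> i = 0\<close>.\<close>
      have "UNIV = {i, j}"
      proof (rule ccontr)
        assume "UNIV \<noteq> {i, j}"
        then obtain l where "l \<noteq> i" "l \<noteq> j" by blast
        then have "\<kappa> l + \<kappa> i = 0" "\<kappa> l + \<kappa> j = 0" using \<kappa>_sum by auto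
        with \<kappa>j i show False by simp
      qed
      then interpret two_inputs D f F h J i j \<sigma> "\<kappa> i"
        using j \<sigma> i e_sum[OF _ j[symmetric]] g_const[of _ i] g_const[of _ j] \<kappa>j curv
        by unfold_locales (simp_all add: g_def)
      show False by (rule contradiction)
    qed
    then interpret balanced_inputs D f F h J \<sigma>
      using \<sigma> g_const curv by unfold_locales (simp_all add: g_def)
    show "\<exists>c. (linearly_homogeneous_on D (\<lambda>x. f x - c) \<and> generalized_ACMS_on D 1 (\<lambda>x. f x - c)) \<or>
         (\<exists>\<alpha>. linearly_homogeneous_on D (\<lambda>x. f x - c) \<and>
              generalized_Cobb_Douglas_on D \<alpha> (\<lambda>x. f x - c) \<and> (\<Sum>i\<in>UNIV. \<alpha> i) = 1)"
      using ACMS_or_Cobb_Douglas ACMS_imp_linearly_homogeneous[OF orthant]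
        Cobb_Douglas_imp_linearly_homogeneous[OF orthant] by blast
  next
    assume "\<exists>c. (linearly_homogeneous_on D (\<lambda>x. f x - c) \<and> generalized_ACMS_on D 1 (\<lambda>x. f x - c)) \<or>
         (\<exists>\<alpha>. linearly_homogeneous_on D (\<lambda>x. f x - c) \<and>
              generalized_Cobb_Douglas_on D \<alpha> (\<lambda>x. f x - c) \<and> (\<Sum>i\<in>UNIV. \<alpha> i) = 1)"
    then obtain c where hom: "linearly_homogeneous_on D (\<lambda>x. f x - c)" by blast
    show "graph_has_vanishing_GK_curvature D f"
      unfolding graph_has_vanishing_GK_curvature_def
    proof
      fix x assume x: "x \<in> D"
      then have "x \<noteq> 0" using D_pos by fastforce
      then show "Gauss_Kronecker_curvature (graph_param f) (graph_normal f) x = 0"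
        using homogeneous_imp_GK_curvature_0[OF open_D hom f_differentiable partial_differentiable x] by blast
    qed
  qed
qed

end
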